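(* Let $M=(M_t)_{t\ge0}$ be a continuous martingale defined on a filtered probability space $(\Omega,\mathcal{F},\mathbb{P},(\mathcal{F}_t)_{t\ge0})$ which satisfies property (P), and let $g=\sup\{t\ge0: M_t=0\}$. Then there exist two $\sigma$-finite measures $\mathcal{Q}^{(+)}$ and $\mathcal{Q}^{(-)}$ on $(\Omega,\mathcal{F})$ such that for any bounded stopping time $T$ and any bounded $\mathcal{F}_T$-measurable random variable $F_T$, $$\left(\mathcal{Q}^{(+)}-\mathcal{Q}^{(-)}\right)\left[F_T\,\mathbf{1}_{g\le T}\right]=\mathbb{E}_{\mathbb{P}}\left[F_TM_T\right].$$ The measures $\mathcal{Q}^{(+)}$ and $\mathcal{Q}^{(-)}$ can be taken to be the measures associated with the submartingales $M^+$ and $M^-$, that is: with $g^{\pm}:=\sup\{t\ge0: M_t^{\pm}=0\}$, $\mathcal{Q}^{(\pm)}$ is the unique $\sigma$-finite measure on $(\Omega,\mathcal{F})$ such that $\mathcal{Q}^{(\pm)}[g^{\pm}=\infty]=0$ and $\mathcal{Q}^{(\pm)}[F_t\mathbf{1}_{g^{\pm}\le t}]=\mathbb{E}_{\mathbb{P}}[F_tM_t^{\pm}]$ for all $t\ge0$ and all bounded $\mathcal{F}_t$-measurable $F_t$.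
   Context: Property (P). Let $(\Omega,\mathcal{F},(\mathcal{F}_t)_{t\ge0})$ be a filtered measurable space such that $\mathcal{F}=\bigvee_{t\ge0}\mathcal{F}_t$ is the $\sigma$-algebra generated by all $\mathcal{F}_t$, $t\ge 0$. It satisfies property (P) if $\mathcal{F}_t=\mathcal{G}_{t+}:=\bigcap_{s>t}\mathcal{G}_s$ for all $t\ge0$, where $(\mathcal{G}_t)_{t\ge0}$ is a filtration such that: (1) for all $t\ge0$, $\mathcal{G}_t$ is generated by a countable number of sets; (2) for all $t\ge0$, there exist a Polish space $\Omega_t$ and a surjective map $\pi_t:\Omega\to\Omega_t$ such that $\mathcal{G}_t$ is the $\sigma$-algebra of inverse images by $\pi_t$ of Borel sets of $\Omega_t$, and such that for all $B\in\mathcal{G}_t$ and $\omega\in\Omega$, $\pi_t(\omega)\in\pi_t(B)$ implies $\omega\in B$; (3) if $(\omega_n)_{n\ge0}$ is a sequence of elements of $\Omega$ such that $\bigcap_{n=0}^N A_n(\omega_n)\neq\emptyset$ for all $N\ge0$, where $A_n(\omega_n)$ denotes the intersection of all sets in $\mathcal{G}_n$ containing $\omega_n$, then $\bigcap_{n=0}^\infty A_n(\omega_n)\neq\emptyset$. The filtration $(\mathcal{F}_t)$ is then right-continuous; it is not assumed to be complete. Notation: $x^+=\max(x,0)$, $x^-=\max(-x,0)$. For a measure $\mathcal{Q}$ and a function $F$, $\mathcal{Q}[F]$ denotes $\int F\,d\mathcal{Q}$, and $(\mathcal{Q}^{(+)}-\mathcal{Q}^{(-)})[F]:=\mathcal{Q}^{(+)}[F]-\mathcal{Q}^{(-)}[F]$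 (both terms being finite in the claim). $\sup\emptyset=0$. Events involving $g$, $g^+$, $g^-$ are understood as measurable with respect to the completion of $\mathcal{F}$ under the measure considered. *)

theory Defs
  imports "HOL-Probability.Probability"
begin

text \<open>
  Time is indexed by the type \<^typ>\<open>real\<close>, but only times \<open>t \<ge> 0\<close> play a role. A filtration
  on \<open>[0, \<infinity>)\<close> is extended to negative times in an arbitrary increasing way, for example by
  \<open>F t = F 0\<close>; neither the hypotheses nor the conclusions below depend on this choice. In
  particular, for \<open>T \<ge> 0\<close> the requirements of \<^const>\<open>stopping_time\<close> and of
  \<^const>\<open>filtration.pre_sigma\<close> at negative times concern the empty set only. The
  \<open>\<sigma>\<close>-algebras \<open>F t\<close> are represented by the \<^const>\<open>sets\<close> of measures whose
  \<^const>\<open>emeasure\<close> is irrelevant.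
\<close>

subsection \<open>Property (P)\<close>

definition polish_topology :: "'b topology \<Rightarrow> bool" where
  "polish_topology X \<longleftrightarrow> completely_metrizable_space X \<and> second_countable X"

definition borel_of_topology :: "'b topology \<Rightarrow> 'b measure" where
  "borel_of_topology X = sigma (topspace X) {U. openin X U}"

definition atom_of :: "'a measure \<Rightarrow> 'a \<Rightarrow> 'a set" where
  "atom_of G \<omega> = \<Inter>{A \<in> sets G. \<omega> \<in> A}"

definition countably_generated :: "'a measure \<Rightarrow> bool" where
  "countably_generated G \<longleftrightarrow>
     (\<exists>C. countable C \<and> C \<subseteq> Pow (space G) \<and> sets G = sigma_sets (space G) C)"

text \<open>
  The Polish space is sought among topologies with carrier a subset of the type \<open>'a\<close> of the
  points of \<open>\<Omega>\<close>. This is no restriction: the map \<open>\<pi>\<close> is onto, so any Polish space in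
  this role can be transported along a section of \<open>\<pi>\<close> to a set of representatives in \<open>\<Omega>\<close>.
\<close>

definition polish_generated :: "'a measure \<Rightarrow> bool" where
  "polish_generated G \<longleftrightarrow>
     (\<exists>(X :: 'a topology) \<pi>.
        polish_topology X \<and>
        \<pi> ` space G = topspace X \<and>
        sets G = {\<pi> -` B \<inter> space G | B. B \<in> sets (borel_of_topology X)} \<and>
        (\<forall>B \<in> sets G. \<forall>\<omega> \<in> space G. \<pi> \<omega> \<in> \<pi> ` B \<longrightarrow> \<omega> \<in> B))"

text \<open>In the following definition only the \<open>\<sigma>\<close>-algebra of \<open>P\<close> matters, not the measure.\<close>

definition property_P :: "'a measure \<Rightarrow> (real \<Rightarrow> 'a measure) \<Rightarrow> bool" where
  "property_P P F \<longleftrightarrow>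
     filtration (space P) F \<and>
     sets P = sigma_sets (space P) (\<Union>t\<in>{0..}. sets (F t)) \<and>
     (\<exists>G :: real \<Rightarrow> 'a measure.
        filtration (space P) G \<and>
        (\<forall>t\<ge>0. sets (F t) = (\<Inter>s\<in>{t<..}. sets (G s))) \<and>
        (\<forall>t\<ge>0. countably_generated (G t)) \<and>
        (\<forall>t\<ge>0. polish_generated (G t)) \<and>
        (\<forall>\<omega> :: nat \<Rightarrow> 'a. range \<omega> \<subseteq> space P \<longrightarrow>
           (\<forall>N. (\<Inter>n\<le>N. atom_of (G (real n)) (\<omega> n)) \<noteq> {}) \<longrightarrow>
           (\<Inter>n. atom_of (G (real n)) (\<omega> n)) \<noteq> {}))"

subsection \<open>Continuous martingales and last zeros\<close>

text \<open>
  All paths are required to be continuous: the filtration is not completed, and a \<open>P\<close>-null set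
  need not be null for the associated measures below.
\<close>

definition continuous_martingale ::
    "'a measure \<Rightarrow> (real \<Rightarrow> 'a measure) \<Rightarrow> (real \<Rightarrow> 'a \<Rightarrow> real) \<Rightarrow> bool" where
  "continuous_martingale P F M \<longleftrightarrow>
     (\<forall>t\<ge>0. M t \<in> borel_measurable (F t)) \<and>
     (\<forall>t\<ge>0. integrable P (M t)) \<and>
     (\<forall>s\<ge>0. \<forall>t\<ge>s. AE \<omega> in P. real_cond_exp P (F s) (M t) \<omega> = M s \<omega>) \<and>
     (\<forall>\<omega> \<in> space P. continuous_on {0..} (\<lambda>t. M t \<omega>))"

text \<open>In \<^typ>\<open>ennreal\<close> the supremum of the empty set is \<open>0\<close>.\<close>

definition last_zero :: "(real \<Rightarrow> 'a \<Rightarrow> real) \<Rightarrow> 'a \<Rightarrow> ennreal" where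
  "last_zero X \<omega> = Sup {ennreal t | t. 0 \<le> t \<and> X t \<omega> = 0}"

subsection \<open>The measure associated with a submartingale\<close>

text \<open>
  The completion of \<open>Q\<close> accounts for the convention that events defined through the last zero
  are only required to be \<open>Q\<close>-measurable. Integrability is stated explicitly because the Bochner
  integral of a non-integrable function is \<open>0\<close> by convention.
\<close>

definition associated_measure ::
    "'a measure \<Rightarrow> (real \<Rightarrow> 'a measure) \<Rightarrow> (real \<Rightarrow> 'a \<Rightarrow> real) \<Rightarrow> 'a measure \<Rightarrow> bool" where
  "associated_measure P F X Q \<longleftrightarrow>
     sets Q = sets P \<and>
     sigma_finite_measure Q \<and>
     (AE \<omega> in Q. last_zero X \<omega> \<noteq> \<infinity>) \<and>
     (\<forall>t\<ge>0. \<forall>f \<in> borel_measurable (F t). bounded (f ` space P) \<longrightarrow>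
        integrable (completion Q) (\<lambda>\<omega>. f \<omega> * indicator {\<omega>. last_zero X \<omega> \<le> ennreal t} \<omega>) \<and>
        (\<integral>\<omega>. f \<omega> * indicator {\<omega>. last_zero X \<omega> \<le> ennreal t} \<omega> \<partial>completion Q)
          = (\<integral>\<omega>. f \<omega> * X t \<omega> \<partial>P))"

end

theory Submission
  imports Defs
begin

text \<open>
  For \<open>t \<ge> 0\<close> write \<open>E t\<close> for the event that \<open>M > 0\<close> on \<open>[t, \<infinity>)\<close>, which up to a null set is the
  event that the last zero of \<open>M\<^sup>+\<close> is at most \<open>t\<close>. Optional sampling at the first zero after
  \<open>t\<close> shows that \<open>M s\<close> times the indicator of \<open>M > 0\<close> on \<open>[t, s]\<close> is a nonnegative
  martingale in \<open>s \<ge> t\<close>, hence a consistent family of densities. Property (P) turns it into a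
  finite measure \<open>Q t\<close> on the whole \<open>\<sigma>\<close>-algebra: the Polish quotients embed into
  \<open>\<real>\<^sup>\<nat>\<close>, Kolmogorov's theorem gives a measure on the sequences of points of these quotients, and
  by the condition on atoms every consistent sequence comes from a point of \<open>\<Omega>\<close>. The
  measures \<open>Q n\<close> are the restrictions to \<open>E n\<close> of their supremum, which is therefore the
  associated measure, and uniqueness follows since every associated measure has these restrictions.

  The formula at a stopping time \<open>T\<close> is the limit of the elementary one along grid times strictly
  above \<open>T\<close>. Finally, wherever the last zero of \<open>M\<^sup>+\<close> is finite it is also the last zero of
  \<open>M\<close>, by the intermediate value theorem; applying everything to \<open>M\<close> and \<open>- M\<close> gives the claim.
\<close>

section \<open>Extension of consistent measures\<close>

text \<open>The obstacle is that the sought measure need not be absolutely continuous with respect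
  to \<open>P\<close>. For Brownian motion and t > 0 the event \<open>E t\<close> is
  \<open>P\<close>-null, while \<open>Q t\<close> has total mass E[max (M t) 0] > 0. Densities with
  respect to \<open>P\<close> exist only up to a finite horizon and do not describe the limit, so
  the measure must be built from its finite-horizon restrictions. This is what property (P) is for,
  and it is why the paths are continuous everywhere and not merely almost surely.

  The densities are consistent because a continuous path that leaves the positive half-line is
  exactly 0 at that moment, so killing it there costs no mass.

  Two adjustments make Kolmogorov's theorem applicable. The Polish structure belongs to the
  \<sigma>-algebras \<open>G\<close>, of which \<open>F\<close> is the right limit, so consistency
  is carried from \<open>F\<close> to \<open>G\<close> at integer times by interlacing. The Polish
  spaces vary with time, whereas the projective limit is taken over copies of one space, so all of
  them are embedded in the space of real sequences.\<close>

lemma polish_topology_embedding: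
  fixes X :: "'b topology"
  assumes "polish_topology X"
  obtains h :: "'b \<Rightarrow> nat \<Rightarrow> real"
  where "embedding_map X euclidean h" "h ` topspace X \<in> sets borel"
proof (cases "topspace X = {}")
  case True
  have "embedding_map X (euclidean :: (nat \<Rightarrow> real) topology) (\<lambda>_ _. 0)"
    using True by (intro injective_open_imp_embedding_map)
      (auto simp: open_map_def dest!: openin_subset)
  then show ?thesis
    using that True by auto
next
  case False
  from assms obtain M d where "Metric_space M d" "Metric_space.mcomplete M d"
    and X: "X = Metric_space.mtopology M d"
    unfolding polish_topology_def completely_metrizable_space_def by blast
  then interpret Metric_space M d by simp
  have [simp]: "topspace X = M" using X by simp
  have "separable_space X"
    using assms by (simp add: polish_topology_def second_countable_imp_separable_space)
  then obtain D where D: "countable D" "D \<subseteq> M" "X closure_of D = M"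
    by (auto simp: separable_space_def)
  have "D \<noteq> {}" using D False by auto
  define a where "a = from_nat_into D"
  have ra: "range a = D" using D \<open>D \<noteq> {}\<close> by (simp add: a_def)
  then have aM: "a j \<in> M" for j using D by auto
  \<comment> \<open>The distances to a dense sequence separate points and determine the
    topology.\<close>
  define h where "h x = (\<lambda>j. d x (a j))" for x
  have dense: "\<exists>j. d x (a j) < r" if "x \<in> M" "0 < r" for x r
  proof -
    have "x \<in> X closure_of D" using D that by simp
    moreover have "openin X (mball x r)" using X by simp
    moreover have "x \<in> mball x r" using that by simp
    ultimately obtain y where "y \<in> D" "y \<in> mball x r"
      by (auto simp: in_closure_of)
    then show ?thesis using ra by auto
  qed
  have cont: "continuous_map X euclidean h"
    unfolding euclidean_product_topology[symmetric] continuous_map_componentwise_UNIV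
  proof
    fix j
    have "continuous_map X euclideanreal (\<lambda>x. d x (a j))"
      using continuous_on_mdist[of "a j" "metric (M, d)"] aM
      by (simp add: X mtopology_of commute[of _ "a j"])
    then show "continuous_map X euclidean (\<lambda>x. h x j)" by (simp add: h_def)
  qed
  have inj: "inj_on h M"
  proof
    fix x y assume xy: "x \<in> M" "y \<in> M" "h x = h y"
    show "x = y"
    proof (rule ccontr)
      assume "x \<noteq> y"
      then have "0 < d x y / 2" using xy by simp
      from dense[OF \<open>x \<in> M\<close> this] obtain j where j: "d x (a j) < d x y / 2" by auto
      have "d x (a j) = d y (a j)" using xy(3) by (metis h_def)
      then show False using triangle[of x "a j" y] commute[of y "a j"] j xy aM by auto
    qed
  qed
  \<comment> \<open>Continuity of the inverse: if \<open>a j\<close> is within r/2 of x, the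
    cylinder of sequences whose j-th entry is below r/2 pulls back into the ball of radius r, by the
    triangle inequality.\<close>
  have open_img: "\<exists>V. open V \<and> h ` U = h ` M \<inter> V" if U: "openin X U" for U
  proof -
    have "\<exists>V. open V \<and> h x \<in> V \<and> h ` M \<inter> V \<subseteq> h ` U" if "x \<in> U" for x
    proof -
      have UM: "U \<subseteq> M" using U openin_subset by force
      obtain r where r: "0 < r" "mball x r \<subseteq> U"
        using U \<open>x \<in> U\<close> unfolding X openin_mtopology by auto
      obtain j where j: "d x (a j) < r / 2" using dense[of x "r/2"] r UM \<open>x \<in> U\<close> by auto
      have "open ((\<lambda>y::nat\<Rightarrow>real. y j) -` {..<r/2})"
        by (intro open_vimage continuous_on_product_coordinates open_lessThan)
      moreover have "z \<in> U" if "z \<in> M" "d z (a j) < r / 2" for z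
      proof -
        have "d x z < r"
          using triangle[of x "a j" z] commute[of z "a j"] j that aM UM \<open>x \<in> U\<close> by auto
        then have "z \<in> mball x r" using that UM \<open>x \<in> U\<close> by auto
        then show ?thesis using r by auto
      qed
      ultimately show ?thesis
        using j by (intro exI[of _ "(\<lambda>y. y j) -` {..<r/2}"]) (auto simp: h_def)
    qed
    then obtain V where V: "\<And>x. x \<in> U \<Longrightarrow> open (V x) \<and> h x \<in> V x \<and> h ` M \<inter> V x \<subseteq> h ` U"
      by metis
    have "U \<subseteq> M" using U openin_subset by force
    then show ?thesis
      using V by (intro exI[of _ "\<Union>x\<in>U. V x"]) blast
  qed
  have "embedding_map X (subtopology euclidean (h ` M)) h"
  proof (rule injective_open_imp_embedding_map)
    show "continuous_map X (top_of_set (h ` M)) h"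
      using cont by (simp add: continuous_map_in_subtopology)
    show "open_map X (top_of_set (h ` M)) h"
      unfolding open_map_def openin_subtopology using open_img by (metis inf_commute open_openin)
  qed (use inj in simp)
  then have emb: "embedding_map X euclidean h"
    by (simp add: embedding_map_in_subtopology)
  then have "X homeomorphic_space subtopology euclidean (h ` M)"
    using embedding_map_imp_homeomorphic_space by force
  then have "completely_metrizable_space (subtopology euclidean (h ` M))"
    using assms homeomorphic_completely_metrizable_space polish_topology_def by blast
  \<comment> \<open>A completely metrizable subspace of a completely metrizable space is a G-delta
    set, hence Borel.\<close>
  then have "gdelta_in euclidean (h ` M)"
    by (simp add: gdelta_in_eq_completely_metrizable_space completely_metrizable_space_euclidean)
  then have "\<exists>\<U>. countable \<U> \<and> \<U> \<subseteq> Collect (openin euclidean) \<and> \<Inter>\<U> = h ` M"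
    unfolding gdelta_in_alt intersection_of_def by (rule conjunct2)
  then obtain \<U> where \<U>: "countable \<U>" "\<U> \<subseteq> Collect (openin euclidean)" "\<Inter>\<U> = h ` M"
    by (elim exE conjE)
  have "(\<Inter>U\<in>\<U>. U) \<in> sets borel"
    using \<U> by (intro sets.countable_INT'') auto
  then have "h ` M \<in> sets borel"
    using \<U>(3) by simp
  with emb show ?thesis using that by simp
qed

text \<open>Replaces the Polish quotients, which vary with the index, by Borel subsets of one type.
  An embedding pulls the Borel sets of its target back to exactly those of its source, so composing
  \<open>\<pi>\<close> with it does not change the generated \<sigma>-algebra.\<close>

lemma polish_generated_borel_coordinate:
  fixes G :: "'a measure"
  assumes "polish_generated G"
  obtains p :: "'a \<Rightarrow> nat \<Rightarrow> real"
  where "p ` space G \<in> sets borel" "sets G = {p -` B \<inter> space G | B. B \<in> sets borel}"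
proof -
  from assms obtain X :: "'a topology" and \<pi> where X: "polish_topology X"
    and \<pi>: "\<pi> ` space G = topspace X"
    and G: "sets G = {\<pi> -` B \<inter> space G | B. B \<in> sets (borel_of_topology X)}"
    unfolding polish_generated_def by (elim exE conjE) rule
  from polish_topology_embedding[OF X] obtain h :: "'a \<Rightarrow> nat \<Rightarrow> real"
    where emb: "embedding_map X euclidean h" and h: "h ` topspace X \<in> sets borel" by blast
  have hom: "homeomorphic_map X (top_of_set (h ` topspace X)) h"
    using emb by (simp add: embedding_map_def)
  have inj: "inj_on h (topspace X)"
    using hom homeomorphic_imp_injective_map by blast
  have "\<exists>V. open V \<and> U = h -` V \<inter> topspace X" if "openin X U" for U
  proof -
    have U: "U \<subseteq> topspace X" using that openin_subset by blast
    have "openin (top_of_set (h ` topspace X)) (h ` U)"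
      using hom that U by (simp add: homeomorphic_map_openness)
    then obtain V where "open V" "h ` U = h ` topspace X \<inter> V"
      by (auto simp: openin_open)
    then have "U = h -` V \<inter> topspace X"
      using U inj by (auto simp: inj_on_def)
    then show ?thesis using \<open>open V\<close> by blast
  qed
  moreover have "openin X (h -` V \<inter> topspace X)" if "open V" for V
  proof -
    have "continuous_map X euclidean h"
      using homeomorphic_imp_continuous_map[OF hom] continuous_map_into_fulltopology by blast
    then show ?thesis
      using that openin_continuous_map_preimage[of X euclidean h V]
      by (simp add: vimage_def Int_def conj_commute)
  qed
  ultimately have opens: "{U. openin X U} = {h -` V \<inter> topspace X | V. V \<in> {V. open V}}"
    by blast
  have "sets (borel_of_topology X) = sets (vimage_algebra (topspace X) h (sigma UNIV {V. open V}))"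
    unfolding borel_of_topology_def opens by (subst vimage_algebra_sigma) auto
  also have "\<dots> = {h -` B \<inter> topspace X | B. B \<in> sets borel}"
    unfolding borel_def[symmetric] by (simp add: sets_vimage_algebra2)
  finally have borelX: "sets (borel_of_topology X) = {h -` B \<inter> topspace X | B. B \<in> sets borel}" .
  have eq: "\<pi> -` (h -` B \<inter> topspace X) \<inter> space G = (h \<circ> \<pi>) -` B \<inter> space G" for B
    using \<pi> by auto
  have "sets G = {(h \<circ> \<pi>) -` B \<inter> space G | B. B \<in> sets borel}"
  proof (intro set_eqI iffI)
    fix A assume "A \<in> sets G"
    then obtain B where "A = \<pi> -` (h -` B \<inter> topspace X) \<inter> space G" "B \<in> sets borel"
      unfolding G borelX by blast
    then show "A \<in> {(h \<circ> \<pi>) -` B \<inter> space G | B. B \<in> sets borel}"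
      unfolding eq by blast
  next
    fix A assume "A \<in> {(h \<circ> \<pi>) -` B \<inter> space G | B. B \<in> sets borel}"
    then obtain B where "A = \<pi> -` (h -` B \<inter> topspace X) \<inter> space G" "B \<in> sets borel"
      unfolding eq[symmetric] by blast
    then show "A \<in> sets G"
      unfolding G borelX by blast
  qed
  moreover have "(h \<circ> \<pi>) ` space G \<in> sets borel"
    using h unfolding image_comp[symmetric] \<pi> .
  ultimately show ?thesis using that by blast
qed

text \<open>The coordinates \<open>p n\<close> send each \<open>\<nu> n\<close> to a law on
  sequences, and Kolmogorov's theorem supplies the joint law. It gives full mass to the consistent
  sequences, each of which is realized by a point of \<open>\<Omega>\<close>; moving the law to such
  points yields \<open>Q\<close>.\<close>

lemma projective_extension:
  fixes G :: "nat \<Rightarrow> 'a measure" and \<nu> :: "nat \<Rightarrow> 'a measure"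
  assumes space_G: "\<And>n. space (G n) = \<Omega>"
    and mono_G: "\<And>m n. m \<le> n \<Longrightarrow> sets (G m) \<subseteq> sets (G n)"
    and polish: "\<And>n. polish_generated (G n)"
    and atoms: "\<And>\<omega> :: nat \<Rightarrow> 'a. range \<omega> \<subseteq> \<Omega> \<Longrightarrow> (\<And>N. (\<Inter>n\<le>N. atom_of (G n) (\<omega> n)) \<noteq> {}) \<Longrightarrow>
           (\<Inter>n. atom_of (G n) (\<omega> n)) \<noteq> {}"
    and prob: "\<And>n. prob_space (\<nu> n)"
    and sets_\<nu>: "\<And>n. sets (\<nu> n) = sets (G n)"
    and consistent: "\<And>n A. A \<in> sets (G n) \<Longrightarrow> emeasure (\<nu> (Suc n)) A = emeasure (\<nu> n) A"
  shows "\<exists>Q. sets Q = sigma_sets \<Omega> (\<Union>n. sets (G n)) \<and>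
    (\<forall>n. \<forall>A\<in>sets (G n). emeasure Q A = emeasure (\<nu> n) A)"
proof -
  define R where "R n q \<longleftrightarrow> q ` \<Omega> \<in> sets borel \<and> sets (G n) = {q -` B \<inter> \<Omega> | B. B \<in> sets borel}"
    for n and q :: "'a \<Rightarrow> nat \<Rightarrow> real"
  have "\<exists>q. R n q" for n
    unfolding R_def
    by (rule polish_generated_borel_coordinate[OF polish[of n], unfolded space_G]) (rule exI, rule conjI)
  then obtain p where p: "\<And>n. R n (p n)"
    by metis
  have pS: "p n ` \<Omega> \<in> sets borel" for n
    using p[of n] unfolding R_def by (rule conjunct1)
  have pG: "A \<in> sets (G n) \<longleftrightarrow> (\<exists>B\<in>sets borel. A = p n -` B \<inter> \<Omega>)" for A n
    using p[of n] by (simp add: R_def Bex_def conj_commute)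
  have space_\<nu>: "space (\<nu> n) = \<Omega>" for n
    using sets_eq_imp_space_eq[OF sets_\<nu>] by (simp add: space_G)
  have consistent': "emeasure (\<nu> n) A = emeasure (\<nu> m) A" if "m \<le> n" "A \<in> sets (G m)" for m n A
    using that(1)
  proof (induction n rule: dec_induct)
    case (step n)
    then show ?case using mono_G[of m n] that(2) consistent[of A n] by auto
  qed simp
  have p_G: "p j \<in> measurable (G m) borel" if "j \<le> m" for j m
  proof (rule measurableI)
    fix B :: "(nat \<Rightarrow> real) set" assume "B \<in> sets borel"
    then have "p j -` B \<inter> \<Omega> \<in> sets (G j)" unfolding pG by blast
    then show "p j -` B \<inter> space (G m) \<in> sets (G m)"
      using mono_G[OF that] by (auto simp: space_G)
  qed simp
  define t where "t J = (\<lambda>\<omega>. \<lambda>j\<in>J. p j \<omega>)" for J :: "nat set"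
  \<comment> \<open>A level at which all coordinates in \<open>J\<close> are measurable. Inserting 0
    provides a maximum for empty \<open>J\<close>; by \<open>P_eq\<close> any other level bounding
    \<open>J\<close> gives the same law.\<close>
  define N where "N J = Max (insert 0 J)" for J :: "nat set"
  define P where "P J = distr (\<nu> (N J)) (PiM J (\<lambda>_. borel)) (t J)" for J
  have N: "J \<subseteq> {..N J}" if "finite J" for J
    using that by (auto simp: N_def)
  have N_le: "N J \<le> m" if "finite J" "J \<subseteq> {..m}" for J m
    using that by (auto simp: N_def)
  have t_G: "t J \<in> measurable (G m) (PiM J (\<lambda>_. borel))" if "J \<subseteq> {..m}" for J m
    unfolding t_def using that by (intro measurable_restrict p_G) auto
  have t_meas: "t J \<in> measurable (\<nu> m) (PiM J (\<lambda>_. borel))" if "J \<subseteq> {..m}" for J m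
    using t_G[OF that] measurable_cong_sets[OF sets_\<nu> refl] by blast
  have P_eq: "P J = distr (\<nu> m) (PiM J (\<lambda>_. borel)) (t J)" if J: "finite J" "J \<subseteq> {..m}" for J m
  proof (rule measure_eqI)
    fix A assume "A \<in> sets (P J)"
    then have A: "A \<in> sets (PiM J (\<lambda>_. borel))" by (simp add: P_def)
    have "t J -` A \<inter> \<Omega> \<in> sets (G (N J))"
      using measurable_sets[OF t_G[OF N[OF J(1)]] A] by (simp add: space_G)
    then show "emeasure (P J) A = emeasure (distr (\<nu> m) (PiM J (\<lambda>_. borel)) (t J)) A"
      using A consistent'[OF N_le[OF J]] t_meas[OF N[OF J(1)]] t_meas[OF J(2)]
      by (simp add: P_def emeasure_distr space_\<nu>)
  qed (simp add: P_def)

  interpret K: polish_projective UNIV P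
  proof (intro polish_projective.intro projective_family.intro)
    fix J H :: "nat set" assume JH: "J \<subseteq> H" "finite H"
    have H: "H \<subseteq> {..N H}" using N JH by auto
    then have J: "J \<subseteq> {..N H}" "finite J" using JH finite_subset by auto
    have "distr (P H) (PiM J (\<lambda>_. borel)) (\<lambda>f. restrict f J) =
      distr (\<nu> (N H)) (PiM J (\<lambda>_. borel)) ((\<lambda>f. restrict f J) \<circ> t H)"
      unfolding P_def using JH by (intro distr_distr measurable_restrict_subset t_meas H)
    also have "(\<lambda>f. restrict f J) \<circ> t H = t J"
      using JH by (auto simp: t_def fun_eq_iff restrict_def)
    finally show "P J = distr (P H) (PiM J (\<lambda>_. borel)) (\<lambda>f. restrict f J)"
      unfolding P_eq[OF J(2,1)] by (rule sym)
  next
    show "prob_space (P J)" if "finite J" for J :: "nat set"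
      unfolding P_def using that by (intro prob_space.prob_space_distr prob t_meas N)
  qed
  let ?\<Lambda> = "K.lim"
  have space_lim[simp]: "space ?\<Lambda> = UNIV" "space (PiM UNIV (\<lambda>_. borel :: (nat \<Rightarrow> real) measure)) = UNIV"
    by (simp_all add: space_PiM)
  have lim_eq: "emeasure ?\<Lambda> {x. restrict x J \<in> C} = emeasure (\<nu> m) {\<omega>\<in>\<Omega>. t J \<omega> \<in> C}"
    if J: "finite J" "J \<subseteq> {..m}" and C: "C \<in> sets (PiM J (\<lambda>_. borel))" for J m C
  proof -
    have "emeasure ?\<Lambda> (prod_emb UNIV (\<lambda>_. borel) J C) = emeasure (P J) C"
      using J C by (intro K.emeasure_lim_emb) auto
    also have "prod_emb UNIV (\<lambda>_. borel) J C = {x. restrict x J \<in> C}"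
      by (auto simp: prod_emb_def)
    also have "emeasure (P J) C = emeasure (\<nu> m) {\<omega>\<in>\<Omega>. t J \<omega> \<in> C}"
      unfolding P_eq[OF J] using C t_meas[OF J(2)]
      by (auto simp: emeasure_distr space_\<nu> intro!: arg_cong2[where f=emeasure])
    finally show ?thesis .
  qed

  \<comment> \<open>Since \<open>G n\<close> is contained in \<open>G (Suc n)\<close>, the
    coordinate \<open>p n\<close> factors through \<open>p (Suc n)\<close>, and \<open>r n\<close>
    is the factor. The constant value off the range of \<open>p (Suc n)\<close> keeps it measurable
    because that range is Borel.\<close>
  define r where "r n y = (if y \<in> p (Suc n) ` \<Omega> then p n (inv_into \<Omega> (p (Suc n)) y) else (\<lambda>_. 0))" for n y
  have r_p: "r n (p (Suc n) \<omega>) = p n \<omega>" if "\<omega> \<in> \<Omega>" for n \<omega>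
  proof -
    define \<omega>' where "\<omega>' = inv_into \<Omega> (p (Suc n)) (p (Suc n) \<omega>)"
    have \<omega>': "\<omega>' \<in> \<Omega>" "p (Suc n) \<omega>' = p (Suc n) \<omega>"
      unfolding \<omega>'_def using that by (auto intro: inv_into_into f_inv_into_f)
    \<comment> \<open>The fibre of \<open>p n\<close> belongs to \<open>G (Suc n)\<close>, so it is
      a union of fibres of \<open>p (Suc n)\<close>; whichever point \<open>inv_into\<close> picks,
      it has the right \<open>p n\<close>.\<close>
    have "p n -` {p n \<omega>} \<inter> \<Omega> \<in> sets (G n)" unfolding pG by (rule bexI[of _ "{p n \<omega>}"]) auto
    then have "p n -` {p n \<omega>} \<inter> \<Omega> \<in> sets (G (Suc n))"
      using mono_G[of n "Suc n"] by auto
    then obtain B where B: "p n -` {p n \<omega>} \<inter> \<Omega> = p (Suc n) -` B \<inter> \<Omega>"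
      unfolding pG by blast
    have "\<omega> \<in> p (Suc n) -` B \<inter> \<Omega>" using that B by auto
    then have "\<omega>' \<in> p (Suc n) -` B \<inter> \<Omega>" using \<omega>' by auto
    then have "p n \<omega>' = p n \<omega>" unfolding B[symmetric] by auto
    then show ?thesis using that by (simp add: r_def \<omega>'_def)
  qed
  have r_meas[measurable]: "r n \<in> borel_measurable borel" for n
  proof -
    have pS': "{y \<in> space borel. y \<in> p (Suc n) ` \<Omega>} \<in> sets borel" using pS by simp
    have "(\<lambda>y. p n (inv_into \<Omega> (p (Suc n)) y)) \<in> borel_measurable (restrict_space borel (p (Suc n) ` \<Omega>))"
    proof (rule measurableI)
      fix B :: "(nat \<Rightarrow> real) set" assume "B \<in> sets borel"
      then have "p n -` B \<inter> \<Omega> \<in> sets (G n)" unfolding pG by blast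
      then have "p n -` B \<inter> \<Omega> \<in> sets (G (Suc n))" using mono_G[of n "Suc n"] by auto
      then obtain B' where B': "B' \<in> sets borel" "p n -` B \<inter> \<Omega> = p (Suc n) -` B' \<inter> \<Omega>"
        unfolding pG by blast
      have "p n (inv_into \<Omega> (p (Suc n)) y) \<in> B \<longleftrightarrow> y \<in> B'" if "y \<in> p (Suc n) ` \<Omega>" for y
      proof -
        define w where "w = inv_into \<Omega> (p (Suc n)) y"
        have w: "w \<in> \<Omega>" "p (Suc n) w = y"
          unfolding w_def using that by (auto intro: inv_into_into f_inv_into_f)
        have "w \<in> p n -` B \<inter> \<Omega> \<longleftrightarrow> w \<in> p (Suc n) -` B' \<inter> \<Omega>" by (simp only: B'(2))
        then show ?thesis using w unfolding w_def[symmetric] by simp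
      qed
      then have "(\<lambda>y. p n (inv_into \<Omega> (p (Suc n)) y)) -` B \<inter> p (Suc n) ` \<Omega> = B' \<inter> p (Suc n) ` \<Omega>"
        by auto
      then show "(\<lambda>y. p n (inv_into \<Omega> (p (Suc n)) y)) -` B \<inter> space (restrict_space borel (p (Suc n) ` \<Omega>))
          \<in> sets (restrict_space borel (p (Suc n) ` \<Omega>))"
        using B' pS by (auto simp: space_restrict_space sets_restrict_space)
    qed simp
    then show ?thesis
      unfolding r_def using pS by (intro measurable_If_restrict_space_iff[THEN iffD2]) auto
  qed

  \<comment> \<open>Comparing successive coordinates already forces consistency, and it presents
    \<open>L\<close> as a countable intersection of measurable conditions.\<close>
  define L where "L = {x. \<forall>n. x n \<in> p n ` \<Omega> \<and> r n (x (Suc n)) = x n}"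
  have [measurable]: "p n ` \<Omega> \<in> sets borel" for n by (rule pS)
  have [measurable_cong]: "sets ?\<Lambda> = sets (PiM UNIV (\<lambda>_. borel))" by simp
  have [measurable]: "Measurable.pred ?\<Lambda> (\<lambda>x. r n (x (Suc n)) = x n)" for n
    unfolding pred_def by (intro measurable_equality_set) measurable
  have "AE x in ?\<Lambda>. x n \<in> p n ` \<Omega> \<and> r n (x (Suc n)) = x n" for n
  proof -
    \<comment> \<open>Each condition concerns two coordinates only, so its probability can be
      computed under \<open>\<nu> (Suc n)\<close>, where it holds at every point by
      \<open>r_p\<close>.\<close>
    define C where "C = {y \<in> space (PiM {n, Suc n} (\<lambda>_. borel)). y n \<in> p n ` \<Omega> \<and> r n (y (Suc n)) = y n}"
    have C: "C \<in> sets (PiM {n, Suc n} (\<lambda>_. borel))"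
    proof -
      have [measurable]: "(\<lambda>y. y n) \<in> borel_measurable (PiM {n, Suc n} (\<lambda>_. borel))"
          "(\<lambda>y. r n (y (Suc n))) \<in> borel_measurable (PiM {n, Suc n} (\<lambda>_. borel))"
        by measurable
      have "Measurable.pred (PiM {n, Suc n} (\<lambda>_. borel)) (\<lambda>y. r n (y (Suc n)) = y n)"
        unfolding pred_def by (intro measurable_equality_set) measurable
      then show ?thesis unfolding C_def by measurable
    qed
    have "{\<omega>\<in>\<Omega>. t {n, Suc n} \<omega> \<in> C} = space (\<nu> (Suc n))"
      using r_p by (auto simp: C_def t_def space_PiM space_\<nu>)
    then have "emeasure ?\<Lambda> {x. restrict x {n, Suc n} \<in> C} = 1"
      using C by (subst lim_eq[of "{n, Suc n}" "Suc n" C]) (auto simp: prob_space.emeasure_space_1[OF prob])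
    also have "{x. restrict x {n, Suc n} \<in> C} =
        {x\<in>space ?\<Lambda>. x n \<in> p n ` \<Omega> \<and> r n (x (Suc n)) = x n}"
      by (auto simp: C_def space_PiM)
    finally have *: "emeasure ?\<Lambda> {x\<in>space ?\<Lambda>. x n \<in> p n ` \<Omega> \<and> r n (x (Suc n)) = x n} = 1" .
    have "{x\<in>space ?\<Lambda>. x n \<in> p n ` \<Omega> \<and> r n (x (Suc n)) = x n} \<in> sets ?\<Lambda>"
      by measurable
    then show ?thesis
      using * by (subst K.P.AE_iff_emeasure_eq_1) auto
  qed
  then have AE_L: "AE x in ?\<Lambda>. x \<in> L"
    unfolding L_def by (simp add: AE_all_countable)
  have L_sets: "L \<in> sets ?\<Lambda>"
  proof -
    have "L = {x\<in>space ?\<Lambda>. \<forall>n. x n \<in> p n ` \<Omega> \<and> r n (x (Suc n)) = x n}"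
      by (auto simp: L_def space_PiM)
    also have "\<dots> \<in> sets ?\<Lambda>" by measurable
    finally show ?thesis .
  qed

  \<comment> \<open>Singletons are Borel in the space of sequences, so atoms are fibres of the
    coordinates. The hypothesis on atoms thus becomes a statement about common points of
    fibres.\<close>
  have atom: "atom_of (G n) \<omega> = {\<omega>'\<in>\<Omega>. p n \<omega>' = p n \<omega>}" if "\<omega> \<in> \<Omega>" for n \<omega>
  proof
    have "p n -` {p n \<omega>} \<inter> \<Omega> \<in> sets (G n)" unfolding pG by (rule bexI[of _ "{p n \<omega>}"]) auto
    then show "atom_of (G n) \<omega> \<subseteq> {\<omega>'\<in>\<Omega>. p n \<omega>' = p n \<omega>}"
      using that by (fastforce simp: atom_of_def)
    show "{\<omega>'\<in>\<Omega>. p n \<omega>' = p n \<omega>} \<subseteq> atom_of (G n) \<omega>"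
      using that by (auto simp: atom_of_def pG)
  qed
  have "\<exists>\<omega>\<in>\<Omega>. \<forall>n. p n \<omega> = x n" if x: "x \<in> L" for x
  proof -
    have xS: "x n \<in> p n ` \<Omega>" for n using x by (simp add: L_def)
    have "\<exists>\<omega>\<in>\<Omega>. p n \<omega> = x n" for n using xS[of n] by (metis image_iff)
    then obtain w where w: "\<And>n. w n \<in> \<Omega>" "\<And>n. p n (w n) = x n" by metis
    have pw: "p n (w m) = x n" if "n \<le> m" for m n
      using that
    proof (induction n rule: inc_induct)
      case (step n)
      have "p n (w m) = r n (x (Suc n))" using step r_p[OF w(1), of n m] by simp
      then show ?case using x by (simp add: L_def)
    qed (simp add: w)
    \<comment> \<open>The last point is a witness for the finite intersection: by \<open>pw\<close>
      it has all earlier coordinates right.\<close>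
    have "w M \<in> (\<Inter>n\<le>M. atom_of (G n) (w n))" for M
      using pw w by (auto simp: atom)
    then have "(\<Inter>n. atom_of (G n) (w n)) \<noteq> {}"
      using w by (intro atoms) blast+
    then obtain \<omega> where "\<And>n. \<omega> \<in> atom_of (G n) (w n)" by auto
    then show ?thesis using w by (auto simp: atom)
  qed
  then obtain s where s: "\<And>x. x \<in> L \<Longrightarrow> s x \<in> \<Omega>" "\<And>x n. x \<in> L \<Longrightarrow> p n (s x) = x n"
    by metis

  let ?G = "\<Union>n. sets (G n)"
  have G_Pow: "?G \<subseteq> Pow \<Omega>" using sets.space_closed space_G by force
  define Q where "Q = distr (restrict_space ?\<Lambda> L) (sigma \<Omega> ?G) s"
  have space_L: "space (restrict_space ?\<Lambda> L) = L" by (simp add: space_restrict_space space_lim)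
  \<comment> \<open>The preimage of a generator under \<open>s\<close> is a cylinder whichever
    points \<open>s\<close> selects, so \<open>s\<close> is measurable for any choice.\<close>
  have pre: "s -` (p n -` B \<inter> \<Omega>) \<inter> L = {x. x n \<in> B} \<inter> L" for n B
    using s by auto
  have coord: "{x. x n \<in> B} \<in> sets ?\<Lambda>" if "B \<in> sets borel" for n B
  proof -
    have "{x. x n \<in> B} = {x\<in>space ?\<Lambda>. x n \<in> B}" by (simp add: space_lim)
    also have "\<dots> \<in> sets ?\<Lambda>" using that by measurable
    finally show ?thesis .
  qed
  have s_meas: "s \<in> measurable (restrict_space ?\<Lambda> L) (sigma \<Omega> ?G)"
  proof (rule measurable_measure_of[OF G_Pow])
    show "s \<in> space (restrict_space ?\<Lambda> L) \<rightarrow> \<Omega>" using s by (simp add: space_L)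
    fix A assume "A \<in> ?G"
    then obtain n where "A \<in> sets (G n)" by blast
    then obtain B where B: "A = p n -` B \<inter> \<Omega>" "B \<in> sets borel" unfolding pG by (elim bexE)
    show "s -` A \<inter> space (restrict_space ?\<Lambda> L) \<in> sets (restrict_space ?\<Lambda> L)"
      unfolding B(1) space_L pre using coord[OF B(2), of n]
      by (auto simp: sets_restrict_space)
  qed
  have "emeasure Q A = emeasure (\<nu> n) A" if A: "A \<in> sets (G n)" for n A
  proof -
    from A obtain B where B: "A = p n -` B \<inter> \<Omega>" "B \<in> sets borel" unfolding pG by (elim bexE)
    have "A \<in> sets (sigma \<Omega> ?G)" using A G_Pow by auto
    then have "emeasure Q A = emeasure (restrict_space ?\<Lambda> L) ({x. x n \<in> B} \<inter> L)"
      unfolding Q_def using s_meas by (simp only: emeasure_distr space_L pre B(1))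
    also have "\<dots> = emeasure ?\<Lambda> ({x. x n \<in> B} \<inter> L)"
      using L_sets by (intro emeasure_restrict_space) (auto simp: space_lim)
    also have "\<dots> = emeasure ?\<Lambda> {x. x n \<in> B}"
      using AE_L L_sets coord[OF B(2), of n] by (intro emeasure_eq_AE) (auto simp: space_lim)
    also have "{x. x n \<in> B} = {x. restrict x {n} \<in> {y\<in>space (PiM {n} (\<lambda>_. borel)). y n \<in> B}}"
      by (auto simp: space_PiM)
    also have "emeasure ?\<Lambda> \<dots> = emeasure (\<nu> n) {\<omega>\<in>\<Omega>. t {n} \<omega> \<in> {y\<in>space (PiM {n} (\<lambda>_. borel)). y n \<in> B}}"
      using B(2) by (intro lim_eq) auto
    also have "{\<omega>\<in>\<Omega>. t {n} \<omega> \<in> {y\<in>space (PiM {n} (\<lambda>_. borel)). y n \<in> B}} = A"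
      by (auto simp: B(1) t_def space_PiM)
    finally show ?thesis .
  qed
  moreover have "sets Q = sigma_sets \<Omega> ?G"
    unfolding Q_def using G_Pow by simp
  ultimately show ?thesis by blast
qed

section \<open>Optional sampling for continuous martingales\<close>

text \<open>Domination of the excess over every level K by that of one integrable function is a form
  of uniform integrability, and the one that convexity delivers directly for martingales. Truncation
  at a high level leaves a bounded part, handled by dominated convergence, and two uniformly small
  excess integrals.\<close>

lemma (in finite_measure) tendsto_L1_uniformly_integrable:
  fixes h :: "nat \<Rightarrow> 'a \<Rightarrow> real"
  assumes h: "\<And>k. integrable M (h k)" and Y: "integrable M Y"
    and lim: "\<And>\<omega>. \<omega> \<in> space M \<Longrightarrow> (\<lambda>k. h k \<omega>) \<longlonglongrightarrow> l \<omega>"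
    and bound: "\<And>k K. 0 \<le> K \<Longrightarrow>
      (\<integral>\<omega>. max (\<bar>h k \<omega>\<bar> - K) 0 \<partial>M) \<le> (\<integral>\<omega>. max (\<bar>Y \<omega>\<bar> - K) 0 \<partial>M)"
  shows "integrable M l" "(\<lambda>k. \<integral>\<omega>. \<bar>h k \<omega> - l \<omega>\<bar> \<partial>M) \<longlonglongrightarrow> 0"
proof -
  have [measurable]: "h k \<in> borel_measurable M" "Y \<in> borel_measurable M" for k
    using h Y by auto
  have [measurable]: "l \<in> borel_measurable M"
    using lim by (rule borel_measurable_LIMSEQ_real) measurable
  \<comment> \<open>Fatou's lemma, with the uniform bound taken from the level K = 0.\<close>
  show int_l: "integrable M l"
  proof (rule integrableI_bounded)
    have "(\<integral>\<^sup>+\<omega>. ennreal (norm (l \<omega>)) \<partial>M) = (\<integral>\<^sup>+\<omega>. liminf (\<lambda>k. ennreal \<bar>h k \<omega>\<bar>) \<partial>M)"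
    proof (rule nn_integral_cong)
      fix \<omega> assume "\<omega> \<in> space M"
      then have "(\<lambda>k. ennreal \<bar>h k \<omega>\<bar>) \<longlonglongrightarrow> ennreal (norm (l \<omega>))"
        using lim by (auto intro!: tendsto_ennrealI tendsto_rabs)
      then show "ennreal (norm (l \<omega>)) = liminf (\<lambda>k. ennreal \<bar>h k \<omega>\<bar>)"
        using lim_imp_Liminf[of sequentially] by force
    qed
    also have "\<dots> \<le> liminf (\<lambda>k. \<integral>\<^sup>+\<omega>. ennreal \<bar>h k \<omega>\<bar> \<partial>M)"
      by (rule nn_integral_liminf) measurable
    also have "\<dots> \<le> liminf (\<lambda>k. ennreal (\<integral>\<omega>. \<bar>Y \<omega>\<bar> \<partial>M))"
    proof (intro Liminf_mono eventuallyI)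
      fix k
      have "(\<integral>\<^sup>+\<omega>. ennreal \<bar>h k \<omega>\<bar> \<partial>M) = ennreal (\<integral>\<omega>. \<bar>h k \<omega>\<bar> \<partial>M)"
        using h by (intro nn_integral_eq_integral) auto
      also have "\<dots> \<le> ennreal (\<integral>\<omega>. \<bar>Y \<omega>\<bar> \<partial>M)"
        using bound[of 0 k] by (simp add: max_absorb1)
      finally show "(\<integral>\<^sup>+\<omega>. ennreal \<bar>h k \<omega>\<bar> \<partial>M) \<le> ennreal (\<integral>\<omega>. \<bar>Y \<omega>\<bar> \<partial>M)" .
    qed
    also have "\<dots> < \<infinity>" by (simp add: Liminf_const)
    finally show "(\<integral>\<^sup>+\<omega>. ennreal (norm (l \<omega>)) \<partial>M) < \<infinity>" .
  qed measurable
  have tail: "(\<lambda>n::nat. \<integral>\<omega>. max (\<bar>g \<omega>\<bar> - real n) 0 \<partial>M) \<longlonglongrightarrow> 0"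
    if g: "integrable M g" for g :: "'a \<Rightarrow> real"
  proof -
    have [measurable]: "g \<in> borel_measurable M" using g by auto
    have "(\<lambda>n. \<integral>\<omega>. max (\<bar>g \<omega>\<bar> - real n) 0 \<partial>M) \<longlonglongrightarrow> (\<integral>\<omega>. 0 \<partial>M)"
    proof (rule integral_dominated_convergence[where w="\<lambda>\<omega>. \<bar>g \<omega>\<bar>"])
      show "AE \<omega> in M. (\<lambda>n. max (\<bar>g \<omega>\<bar> - real n) 0) \<longlonglongrightarrow> 0"
      proof (rule AE_I2)
        fix \<omega>
        obtain n0 where "\<bar>g \<omega>\<bar> \<le> real n0" using real_arch_simple by blast
        then have "\<forall>\<^sub>F n in sequentially. max (\<bar>g \<omega>\<bar> - real n) 0 = 0"
          unfolding eventually_sequentially by (intro exI[of _ n0]) auto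
        then show "(\<lambda>n. max (\<bar>g \<omega>\<bar> - real n) 0) \<longlonglongrightarrow> 0" by (rule tendsto_eventually)
      qed
    qed (use g in \<open>auto intro!: AE_I2\<close>)
    then show ?thesis by simp
  qed
  show "(\<lambda>k. \<integral>\<omega>. \<bar>h k \<omega> - l \<omega>\<bar> \<partial>M) \<longlonglongrightarrow> 0"
  proof (rule LIMSEQ_I)
    fix e :: real assume e: "0 < e"
    have "\<forall>\<^sub>F n::nat in sequentially. (\<integral>\<omega>. max (\<bar>Y \<omega>\<bar> - real n) 0 \<partial>M) < e/3 \<and>
        (\<integral>\<omega>. max (\<bar>l \<omega>\<bar> - real n) 0 \<partial>M) < e/3"
      using e order_tendstoD(2)[OF tail[OF Y], of "e/3"] order_tendstoD(2)[OF tail[OF int_l], of "e/3"]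
      by (intro eventually_conj) auto
    then obtain n :: nat where n: "(\<integral>\<omega>. max (\<bar>Y \<omega>\<bar> - real n) 0 \<partial>M) < e/3"
        "(\<integral>\<omega>. max (\<bar>l \<omega>\<bar> - real n) 0 \<partial>M) < e/3"
      using eventually_happens'[OF sequentially_bot] by blast
    \<comment> \<open>Truncation to the interval from -n to n. It moves a number by exactly its
      excess over n, whence \<open>c_split\<close>.\<close>
    define c where "c x = max (- real n) (min x (real n))" for x
    have [measurable]: "c \<in> borel_measurable borel" unfolding c_def by measurable
    have c_bound: "\<bar>c x\<bar> \<le> real n" for x by (auto simp: c_def)
    have c_split: "\<bar>x - y\<bar> \<le> \<bar>c x - c y\<bar> + max (\<bar>x\<bar> - real n) 0 + max (\<bar>y\<bar> - real n) 0" for x y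
      unfolding c_def max_def min_def abs_if by auto
    have c_bound2: "\<bar>c x - c y\<bar> \<le> 2 * real n" for x y using c_bound[of x] c_bound[of y] by linarith
    have "(\<lambda>k. \<integral>\<omega>. \<bar>c (h k \<omega>) - c (l \<omega>)\<bar> \<partial>M) \<longlonglongrightarrow> (\<integral>\<omega>. 0 \<partial>M)"
    proof (rule integral_dominated_convergence[where w="\<lambda>\<omega>. 2 * real n"])
      show "AE \<omega> in M. (\<lambda>k. \<bar>c (h k \<omega>) - c (l \<omega>)\<bar>) \<longlonglongrightarrow> 0"
      proof (rule AE_I2)
        fix \<omega> assume "\<omega> \<in> space M"
        then have "(\<lambda>k. c (h k \<omega>)) \<longlonglongrightarrow> c (l \<omega>)"
          unfolding c_def by (intro tendsto_intros lim)
        then have "(\<lambda>k. \<bar>c (h k \<omega>) - c (l \<omega>)\<bar>) \<longlonglongrightarrow> \<bar>c (l \<omega>) - c (l \<omega>)\<bar>"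
          by (intro tendsto_intros)
        then show "(\<lambda>k. \<bar>c (h k \<omega>) - c (l \<omega>)\<bar>) \<longlonglongrightarrow> 0" by simp
      qed
    qed (use c_bound2 in auto)
    then obtain k0 where k0: "\<And>k. k \<ge> k0 \<Longrightarrow> (\<integral>\<omega>. \<bar>c (h k \<omega>) - c (l \<omega>)\<bar> \<partial>M) < e/3"
      using e LIMSEQ_D[of _ 0 "e/3"] by (fastforce simp: abs_less_iff)
    have "norm ((\<integral>\<omega>. \<bar>h k \<omega> - l \<omega>\<bar> \<partial>M) - 0) < e" if "k \<ge> k0" for k
    proof -
      have i1: "integrable M (\<lambda>\<omega>. \<bar>c (h k \<omega>) - c (l \<omega>)\<bar>)"
        using c_bound2 by (intro integrable_const_bound[where B="2 * real n"]) auto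
      have i2: "integrable M (\<lambda>\<omega>. max (\<bar>h k \<omega>\<bar> - real n) 0)"
        using h by (intro integrable_max) auto
      have i3: "integrable M (\<lambda>\<omega>. max (\<bar>l \<omega>\<bar> - real n) 0)"
        using int_l by (intro integrable_max) auto
      have "(\<integral>\<omega>. \<bar>h k \<omega> - l \<omega>\<bar> \<partial>M) \<le>
        (\<integral>\<omega>. \<bar>c (h k \<omega>) - c (l \<omega>)\<bar> + max (\<bar>h k \<omega>\<bar> - real n) 0 + max (\<bar>l \<omega>\<bar> - real n) 0 \<partial>M)"
        using h int_l i1 i2 i3 by (intro integral_mono c_split) auto
      also have "\<dots> = (\<integral>\<omega>. \<bar>c (h k \<omega>) - c (l \<omega>)\<bar> \<partial>M) + (\<integral>\<omega>. max (\<bar>h k \<omega>\<bar> - real n) 0 \<partial>M)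
          + (\<integral>\<omega>. max (\<bar>l \<omega>\<bar> - real n) 0 \<partial>M)"
        using i1 i2 i3 by simp
      also have "\<dots> < e"
        using k0[OF that] n bound[of "real n" k] by simp
      finally show ?thesis by simp
    qed
    then show "\<exists>no. \<forall>k\<ge>no. norm ((\<integral>\<omega>. \<bar>h k \<omega> - l \<omega>\<bar> \<partial>M) - 0) < e" by blast
  qed
qed

lemma integrable_bounded_mult:
  fixes f g :: "'a \<Rightarrow> real"
  assumes "f \<in> borel_measurable M" "\<And>x. x \<in> space M \<Longrightarrow> \<bar>f x\<bar> \<le> C" "integrable M g"
  shows "integrable M (\<lambda>x. f x * g x)"
proof (rule Bochner_Integration.integrable_bound[where f="\<lambda>x. C * \<bar>g x\<bar>"])
  show "AE x in M. norm (f x * g x) \<le> norm (C * \<bar>g x\<bar>)"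
    using assms(2) by (intro AE_I2) (auto simp: abs_mult intro!: mult_right_mono order_trans[OF assms(2) abs_ge_self])
qed (use assms in auto)

lemma tendsto_integral_mult_L1:
  fixes h :: "nat \<Rightarrow> 'a \<Rightarrow> real"
  assumes h: "\<And>k. integrable M (h k)" and l: "integrable M l"
    and lim: "(\<lambda>k. \<integral>\<omega>. \<bar>h k \<omega> - l \<omega>\<bar> \<partial>M) \<longlonglongrightarrow> 0"
    and f: "f \<in> borel_measurable M" "\<And>\<omega>. \<omega> \<in> space M \<Longrightarrow> \<bar>f \<omega>\<bar> \<le> C"
  shows "(\<lambda>k. \<integral>\<omega>. f \<omega> * h k \<omega> \<partial>M) \<longlonglongrightarrow> (\<integral>\<omega>. f \<omega> * l \<omega> \<partial>M)"
proof -
  have fint: "integrable M (\<lambda>\<omega>. f \<omega> * g \<omega>)" if "integrable M g" for g :: "'a \<Rightarrow> real"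
    using f that by (rule integrable_bounded_mult)
  show ?thesis
  proof (rule LIM_zero_cancel, rule Lim_null_comparison[where g="\<lambda>k. C * (\<integral>\<omega>. \<bar>h k \<omega> - l \<omega>\<bar> \<partial>M)"])
    show "\<forall>\<^sub>F k in sequentially. norm ((\<integral>\<omega>. f \<omega> * h k \<omega> \<partial>M) - (\<integral>\<omega>. f \<omega> * l \<omega> \<partial>M))
        \<le> C * (\<integral>\<omega>. \<bar>h k \<omega> - l \<omega>\<bar> \<partial>M)"
    proof (rule eventuallyI)
      fix k
      have "(\<integral>\<omega>. f \<omega> * h k \<omega> \<partial>M) - (\<integral>\<omega>. f \<omega> * l \<omega> \<partial>M) = (\<integral>\<omega>. f \<omega> * (h k \<omega> - l \<omega>) \<partial>M)"
        using fint[OF h] fint[OF l] by (simp add: right_diff_distrib)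
      also have "norm \<dots> \<le> (\<integral>\<omega>. norm (f \<omega> * (h k \<omega> - l \<omega>)) \<partial>M)"
        by (rule integral_norm_bound)
      also have "\<dots> \<le> (\<integral>\<omega>. C * \<bar>h k \<omega> - l \<omega>\<bar> \<partial>M)"
        using h l f(2) by (intro integral_mono integrable_norm fint) (auto simp: abs_mult intro!: mult_right_mono)
      finally show "norm ((\<integral>\<omega>. f \<omega> * h k \<omega> \<partial>M) - (\<integral>\<omega>. f \<omega> * l \<omega> \<partial>M))
        \<le> C * (\<integral>\<omega>. \<bar>h k \<omega> - l \<omega>\<bar> \<partial>M)" by simp
    qed
    show "(\<lambda>k. C * (\<integral>\<omega>. \<bar>h k \<omega> - l \<omega>\<bar> \<partial>M)) \<longlonglongrightarrow> 0"
      using tendsto_mult_left[OF lim, of C] by simp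
  qed
qed

lemma (in filtration) borel_measurable_pre_sigma_stopped:
  fixes f :: "'a \<Rightarrow> real"
  assumes T: "stopping_time F T" and f: "f \<in> borel_measurable (pre_sigma T)"
  shows "(\<lambda>\<omega>. if T \<omega> \<le> t then f \<omega> else 0) \<in> borel_measurable (F t)"
proof -
  have le: "{\<omega>\<in>space (F t). T \<omega> \<le> t} \<in> sets (F t)"
    using stopping_timeD[OF T] by (simp add: pred_def)
  have "f \<in> borel_measurable (restrict_space (F t) {\<omega>. T \<omega> \<le> t})"
  proof (rule measurableI)
    fix B :: "real set" assume B: "B \<in> sets borel"
    have "{\<omega> \<in> f -` B \<inter> space (pre_sigma T). T \<omega> \<le> t} \<in> sets (F t)"
      using sets_pre_sigmaD[OF T measurable_sets[OF f B]] .
    also have "{\<omega> \<in> f -` B \<inter> space (pre_sigma T). T \<omega> \<le> t} =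
        f -` B \<inter> space (restrict_space (F t) {\<omega>. T \<omega> \<le> t})"
      by (auto simp: space_pre_sigma space_restrict_space space_F)
    also have "\<dots> \<in> sets (F t) \<longleftrightarrow> \<dots> \<in> sets (restrict_space (F t) {\<omega>. T \<omega> \<le> t})"
      using le by (subst sets_restrict_space_iff) (auto simp: Int_def space_restrict_space conj_commute)
    finally show "f -` B \<inter> space (restrict_space (F t) {\<omega>. T \<omega> \<le> t})
        \<in> sets (restrict_space (F t) {\<omega>. T \<omega> \<le> t})" .
  qed simp
  then show ?thesis
    using le by (subst measurable_If_restrict_space_iff) auto
qed

section \<open>Martingale inequalities and grid approximation of random times\<close>

locale filtered_continuous_martingale = prob_space P + filtration "space P" F
  for P :: "'a measure" and F :: "real \<Rightarrow> 'a measure" +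
  fixes M :: "real \<Rightarrow> 'a \<Rightarrow> real"
  assumes sets_F_le: "\<And>t. sets (F t) \<subseteq> sets P"
    and martingale: "continuous_martingale P F M"
begin

lemma measurable_F_P: "f \<in> borel_measurable (F t) \<Longrightarrow> f \<in> borel_measurable P"
  using sets_F_le[of t] space_F by (auto simp: measurable_def)

lemma measurable_F_mono: "s \<le> t \<Longrightarrow> f \<in> borel_measurable (F s) \<Longrightarrow> f \<in> borel_measurable (F t)"
  using sets_F_mono[of s t] space_F by (auto simp: measurable_def)

lemma adapted: "0 \<le> t \<Longrightarrow> M t \<in> borel_measurable (F t)"
  and integrable_M: "0 \<le> t \<Longrightarrow> integrable P (M t)"
  and path: "\<omega> \<in> space P \<Longrightarrow> continuous_on {0..} (\<lambda>t. M t \<omega>)"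
  using martingale by (auto simp: continuous_martingale_def)

lemma measurable_M: "0 \<le> t \<Longrightarrow> M t \<in> borel_measurable P"
  using adapted measurable_F_P by blast

lemma sigma_finite_subalgebra_F: "sigma_finite_subalgebra P (F s)"
proof -
  have sub: "subalgebra P (F s)"
    using sets_F_le space_F by (simp add: subalgebra_def)
  show ?thesis
    by (rule sigma_finite_subalgebra.intro[OF sub])
      (intro finite_measure.sigma_finite_measure finite_measure_restr_to_subalg sub finite_measure_axioms)
qed

lemma martingale_integral:
  assumes st: "0 \<le> s" "s \<le> t" and f: "f \<in> borel_measurable (F s)"
    and bound: "\<And>\<omega>. \<omega> \<in> space P \<Longrightarrow> \<bar>f \<omega>\<bar> \<le> C"
  shows "(\<integral>\<omega>. f \<omega> * M t \<omega> \<partial>P) = (\<integral>\<omega>. f \<omega> * M s \<omega> \<partial>P)"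
proof -
  interpret sigma_finite_subalgebra P "F s"
    by (rule sigma_finite_subalgebra_F)
  have fP: "f \<in> borel_measurable P" using f by (rule measurable_F_P)
  have int: "integrable P (\<lambda>\<omega>. f \<omega> * M t \<omega>)"
    using st by (intro integrable_bounded_mult[OF fP bound] integrable_M) auto
  have "(\<integral>\<omega>. f \<omega> * M t \<omega> \<partial>P) = (\<integral>\<omega>. f \<omega> * real_cond_exp P (F s) (M t) \<omega> \<partial>P)"
    using real_cond_exp_intg(2)[OF int f measurable_M] st by simp
  also have "\<dots> = (\<integral>\<omega>. f \<omega> * M s \<omega> \<partial>P)"
  proof (rule integral_cong_AE)
    show "AE \<omega> in P. f \<omega> * real_cond_exp P (F s) (M t) \<omega> = f \<omega> * M s \<omega>"
    proof -
      have "AE \<omega> in P. real_cond_exp P (F s) (M t) \<omega> = M s \<omega>"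
        using martingale st by (simp add: continuous_martingale_def)
      then show ?thesis by eventually_elim simp
    qed
  qed (use fP measurable_M st in auto)
  finally show ?thesis .
qed

lemma martingale_indicator:
  assumes "0 \<le> s" "s \<le> t" "A \<in> sets (F s)"
  shows "(\<integral>\<omega>. indicator A \<omega> * M t \<omega> \<partial>P) = (\<integral>\<omega>. indicator A \<omega> * M s \<omega> \<partial>P)"
  using assms by (intro martingale_integral[where C=1]) (auto simp: indicator_def)

text \<open>With f the sign of \<open>M s\<close> on the part of \<open>A\<close> where the excess
  is positive, f * M s - K * |f| equals the excess at time s on \<open>A\<close>. The same
  expression with \<open>M t\<close> is a supporting line lying below the excess at time t, and f is
  \<open>F s\<close>-measurable, so the martingale property links the two.\<close>

lemma abs_excess_submartingale:
  assumes st: "0 \<le> s" "s \<le> t" and A: "A \<in> sets (F s)" and K: "0 \<le> K"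
  shows "(\<integral>\<omega>. indicator A \<omega> * max (\<bar>M s \<omega>\<bar> - K) 0 \<partial>P) \<le>
    (\<integral>\<omega>. indicator A \<omega> * max (\<bar>M t \<omega>\<bar> - K) 0 \<partial>P)"
proof -
  define f where "f \<omega> = indicator A \<omega> * (if K < \<bar>M s \<omega>\<bar> then sgn (M s \<omega>) else 0)" for \<omega>
  have [measurable]: "M s \<in> borel_measurable (F s)" using st adapted by simp
  have f: "f \<in> borel_measurable (F s)"
    unfolding f_def using A by measurable
  have f_bound: "\<bar>f \<omega>\<bar> \<le> 1" for \<omega>
    by (auto simp: f_def indicator_def sgn_if)
  have A_P: "A \<in> sets P" using A sets_F_le by blast
  have [measurable]: "M s \<in> borel_measurable P" "M t \<in> borel_measurable P"
    using st measurable_M by auto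
  have fP[measurable]: "f \<in> borel_measurable P" using f by (rule measurable_F_P)
  have int_f: "integrable P (\<lambda>\<omega>. f \<omega> * M u \<omega>)" if "0 \<le> u" for u
    using f_bound that by (intro integrable_bounded_mult[OF fP _ integrable_M])
  have int_K: "integrable P (\<lambda>\<omega>. K * \<bar>f \<omega>\<bar>)"
    using f_bound by (intro integrable_mult_right integrable_abs integrable_const_bound[where B=1]) auto
  have int_max: "integrable P (\<lambda>\<omega>. indicator A \<omega> * max (\<bar>M u \<omega>\<bar> - K) 0)" if "0 \<le> u" for u
    using A_P that by (intro integrable_bounded_mult[where C=1] integrable_max)
      (auto simp: indicator_def integrable_M)
  have "(\<integral>\<omega>. indicator A \<omega> * max (\<bar>M s \<omega>\<bar> - K) 0 \<partial>P) = (\<integral>\<omega>. f \<omega> * M s \<omega> - K * \<bar>f \<omega>\<bar> \<partial>P)"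
    using K by (intro Bochner_Integration.integral_cong) (auto simp: f_def indicator_def sgn_if)
  also have "\<dots> = (\<integral>\<omega>. f \<omega> * M t \<omega> - K * \<bar>f \<omega>\<bar> \<partial>P)"
    using int_f int_K st martingale_integral[OF st f f_bound] by simp
  also have "\<dots> \<le> (\<integral>\<omega>. indicator A \<omega> * max (\<bar>M t \<omega>\<bar> - K) 0 \<partial>P)"
    using st int_f int_K int_max
    by (intro integral_mono) (auto simp: f_def indicator_def sgn_if)
  finally show ?thesis .
qed

text \<open>
  The grid time attached to \<open>T\<close> lies strictly above \<open>T\<close>, so that positivity on the closed half-line from
  the grid time converges to positivity on the open half-line \<open>(T, \<infinity>)\<close>.
\<close>

definition grid_index :: "('a \<Rightarrow> real) \<Rightarrow> nat \<Rightarrow> 'a \<Rightarrow> nat" where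
  "grid_index T k \<omega> = nat \<lfloor>real (Suc k) * T \<omega>\<rfloor>"

definition grid_time :: "nat \<Rightarrow> nat \<Rightarrow> real" where
  "grid_time k i = real (Suc i) / real (Suc k)"

definition upper_grid :: "('a \<Rightarrow> real) \<Rightarrow> nat \<Rightarrow> 'a \<Rightarrow> real" where
  "upper_grid T k \<omega> = grid_time k (grid_index T k \<omega>)"

lemma grid_time_nonneg[simp]: "0 \<le> grid_time k i"
  by (simp add: grid_time_def)

lemma grid_index_eq_iff:
  assumes "0 \<le> T \<omega>"
  shows "grid_index T k \<omega> = i \<longleftrightarrow> real i / real (Suc k) \<le> T \<omega> \<and> T \<omega> < grid_time k i"
proof -
  have "grid_index T k \<omega> = i \<longleftrightarrow> \<lfloor>real (Suc k) * T \<omega>\<rfloor> = int i"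
    using assms by (auto simp: grid_index_def)
  also have "\<dots> \<longleftrightarrow> real i \<le> real (Suc k) * T \<omega> \<and> real (Suc k) * T \<omega> < real i + 1"
    by (simp add: floor_eq_iff)
  also have "\<dots> \<longleftrightarrow> real i / real (Suc k) \<le> T \<omega> \<and> T \<omega> < grid_time k i"
    by (simp add: grid_time_def field_simps del: of_nat_Suc) (simp add: algebra_simps)
  finally show ?thesis .
qed

lemma upper_grid_gt: "0 \<le> T \<omega> \<Longrightarrow> T \<omega> < upper_grid T k \<omega>"
  using iffD1[OF grid_index_eq_iff[of T \<omega> k] refl] by (simp add: upper_grid_def)

lemma upper_grid_le: "0 \<le> T \<omega> \<Longrightarrow> upper_grid T k \<omega> \<le> T \<omega> + 1 / real (Suc k)"
  using iffD1[OF grid_index_eq_iff[of T \<omega> k] refl]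
  by (simp add: upper_grid_def grid_time_def add_divide_distrib)

lemma upper_grid_tendsto:
  assumes "0 \<le> T \<omega>"
  shows "(\<lambda>k. upper_grid T k \<omega>) \<longlonglongrightarrow> T \<omega>"
proof (rule tendsto_sandwich)
  show "\<forall>\<^sub>F k in sequentially. T \<omega> \<le> upper_grid T k \<omega>"
    using upper_grid_gt[of T \<omega>] assms by (auto intro!: always_eventually less_imp_le)
  show "\<forall>\<^sub>F k in sequentially. upper_grid T k \<omega> \<le> T \<omega> + inverse (real (Suc k))"
    using upper_grid_le[of T \<omega>] assms by (auto intro!: always_eventually simp: inverse_eq_divide)
  show "(\<lambda>k. T \<omega> + inverse (real (Suc k))) \<longlonglongrightarrow> T \<omega>"
    using tendsto_add[OF tendsto_const LIMSEQ_inverse_real_of_nat, of "T \<omega>"] by simp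
qed simp

end

section \<open>Optional sampling at a bounded stopping time\<close>

locale bounded_stopping_time = filtered_continuous_martingale +
  fixes T :: "'a \<Rightarrow> real" and N :: nat
  assumes stopping: "stopping_time F T"
    and T_nonneg: "\<And>\<omega>. \<omega> \<in> space P \<Longrightarrow> 0 \<le> T \<omega>"
    and T_le: "\<And>\<omega>. \<omega> \<in> space P \<Longrightarrow> T \<omega> \<le> real N"
begin

definition grid_event :: "nat \<Rightarrow> nat \<Rightarrow> 'a set" where
  "grid_event k i = {\<omega>\<in>space P. grid_index T k \<omega> = i}"

abbreviation "grid_size k \<equiv> Suc k * N"

lemma grid_index_le: "\<omega> \<in> space P \<Longrightarrow> grid_index T k \<omega> \<le> grid_size k"
proof -
  assume "\<omega> \<in> space P"
  then have "real (Suc k) * T \<omega> \<le> real (Suc k) * real N"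
    using T_le by (intro mult_left_mono) auto
  then have "\<lfloor>real (Suc k) * T \<omega>\<rfloor> \<le> int (grid_size k)"
    by (simp add: floor_le_iff algebra_simps)
  then show ?thesis by (simp add: grid_index_def nat_le_iff)
qed

text \<open>Grid times lie strictly above \<open>T\<close> and may pass \<open>N\<close> by up to
  1/(k+1). The time \<open>Suc N\<close> bounds them for all k at once, hence its role as terminal
  time below.\<close>

lemma grid_time_le: "i \<le> grid_size k \<Longrightarrow> grid_time k i \<le> real (Suc N)"
proof -
  assume "i \<le> grid_size k"
  then have "real (Suc i) \<le> real (grid_size k + Suc k)" unfolding of_nat_le_iff by simp
  then show ?thesis by (simp add: grid_time_def field_simps)
qed

lemma grid_event_eq:
  "grid_event k i = {\<omega>\<in>space P. \<not> T \<omega> < real i / real (Suc k) \<and> T \<omega> < grid_time k i}"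
  unfolding grid_event_def not_less using grid_index_eq_iff[of T, OF T_nonneg] by blast

lemma grid_event_sets: "grid_event k i \<in> sets (F (grid_time k i))"
proof -
  have "{\<omega>\<in>space P. T \<omega> < real i / real (Suc k)} \<in> sets (F (real i / real (Suc k)))"
    using stopping_time_less_const[OF stopping] by (simp add: pred_def space_F)
  then have 1: "{\<omega>\<in>space P. T \<omega> < real i / real (Suc k)} \<in> sets (F (grid_time k i))"
    using sets_F_mono[of "real i / real (Suc k)" "grid_time k i"]
    by (auto simp: grid_time_def divide_right_mono)
  have 2: "{\<omega>\<in>space P. T \<omega> < grid_time k i} \<in> sets (F (grid_time k i))"
    using stopping_time_less_const[OF stopping] by (simp add: pred_def space_F)
  have "grid_event k i = {\<omega>\<in>space P. T \<omega> < grid_time k i} - {\<omega>\<in>space P. T \<omega> < real i / real (Suc k)}"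
    unfolding grid_event_eq by auto
  then show ?thesis using 1 2 by auto
qed

lemma grid_event_P[measurable]: "grid_event k i \<in> sets P"
  using grid_event_sets sets_F_le by blast

lemma sum_grid_event:
  fixes a :: "nat \<Rightarrow> real"
  assumes "\<omega> \<in> space P"
  shows "(\<Sum>i\<le>grid_size k. indicator (grid_event k i) \<omega> * a i) = a (grid_index T k \<omega>)"
proof -
  have "(\<Sum>i\<le>grid_size k. indicator (grid_event k i) \<omega> * a i) =
      (\<Sum>i\<le>grid_size k. if i = grid_index T k \<omega> then a i else 0)"
    using assms by (intro sum.cong) (auto simp: grid_event_def)
  also have "\<dots> = a (grid_index T k \<omega>)"
    using grid_index_le[OF assms, of k] by simp
  finally show ?thesis .
qed

lemma path_upper_grid:
  assumes "\<omega> \<in> space P"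
  shows "(\<lambda>k. M (upper_grid T k \<omega>) \<omega>) \<longlonglongrightarrow> M (T \<omega>) \<omega>"
proof (rule continuous_on_tendsto_compose[OF path[OF assms] upper_grid_tendsto])
  show "0 \<le> T \<omega>" "T \<omega> \<in> {0..}" using T_nonneg[OF assms] by auto
  show "\<forall>\<^sub>F k in sequentially. upper_grid T k \<omega> \<in> {0..}"
    by (simp add: upper_grid_def)
qed

text \<open>Stated for a general \<open>\<phi>\<close> because the identity, the excess over a level
  and the positive part all occur later.\<close>

lemma integral_upper_grid:
  fixes \<phi> :: "real \<Rightarrow> real"
  assumes f: "f \<in> borel_measurable P"
    and int: "\<And>i. integrable P (\<lambda>\<omega>. f \<omega> * \<phi> (M (grid_time k i) \<omega>))"
  shows "integrable P (\<lambda>\<omega>. f \<omega> * \<phi> (M (upper_grid T k \<omega>) \<omega>))"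
    and "(\<integral>\<omega>. f \<omega> * \<phi> (M (upper_grid T k \<omega>) \<omega>) \<partial>P) =
      (\<Sum>i\<le>grid_size k. \<integral>\<omega>. indicator (grid_event k i) \<omega> * (f \<omega> * \<phi> (M (grid_time k i) \<omega>)) \<partial>P)"
proof -
  have int': "integrable P (\<lambda>\<omega>. indicator (grid_event k i) \<omega> * (f \<omega> * \<phi> (M (grid_time k i) \<omega>)))" for i
    by (intro integrable_bounded_mult[OF _ _ int, where C=1]) (auto simp: indicator_def)
  have eq: "f \<omega> * \<phi> (M (upper_grid T k \<omega>) \<omega>) =
      (\<Sum>i\<le>grid_size k. indicator (grid_event k i) \<omega> * (f \<omega> * \<phi> (M (grid_time k i) \<omega>)))"
    if "\<omega> \<in> space P" for \<omega>
    unfolding sum_grid_event[OF that] upper_grid_def ..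
  show "integrable P (\<lambda>\<omega>. f \<omega> * \<phi> (M (upper_grid T k \<omega>) \<omega>))"
    by (subst Bochner_Integration.integrable_cong[OF refl eq])
      (assumption | rule Bochner_Integration.integrable_sum int')+
  show "(\<integral>\<omega>. f \<omega> * \<phi> (M (upper_grid T k \<omega>) \<omega>) \<partial>P) =
      (\<Sum>i\<le>grid_size k. \<integral>\<omega>. indicator (grid_event k i) \<omega> * (f \<omega> * \<phi> (M (grid_time k i) \<omega>)) \<partial>P)"
    by (subst Bochner_Integration.integral_cong[OF refl eq])
      (assumption | rule Bochner_Integration.integral_sum int')+
qed

lemma integrable_upper_grid: "integrable P (\<lambda>\<omega>. M (upper_grid T k \<omega>) \<omega>)"
  using integral_upper_grid(1)[of "\<lambda>_. 1" "\<lambda>x. x" k] integrable_M by simp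

lemma abs_excess_upper_grid:
  assumes K: "0 \<le> K"
  shows "(\<integral>\<omega>. max (\<bar>M (upper_grid T k \<omega>) \<omega>\<bar> - K) 0 \<partial>P) \<le>
    (\<integral>\<omega>. max (\<bar>M (real (Suc N)) \<omega>\<bar> - K) 0 \<partial>P)"
proof -
  have int: "integrable P (\<lambda>\<omega>. max (\<bar>M t \<omega>\<bar> - K) 0)" if "0 \<le> t" for t
    using that by (intro integrable_max) (auto simp: integrable_M)
  have int': "integrable P (\<lambda>\<omega>. indicator (grid_event k i) \<omega> * max (\<bar>M (real (Suc N)) \<omega>\<bar> - K) 0)" for i
    by (intro integrable_bounded_mult[OF _ _ int, where C=1]) (auto simp: indicator_def)
  have "(\<integral>\<omega>. max (\<bar>M (upper_grid T k \<omega>) \<omega>\<bar> - K) 0 \<partial>P) =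
      (\<Sum>i\<le>grid_size k. \<integral>\<omega>. indicator (grid_event k i) \<omega> * max (\<bar>M (grid_time k i) \<omega>\<bar> - K) 0 \<partial>P)"
    using integral_upper_grid(2)[of "\<lambda>_. 1" "\<lambda>x. max (\<bar>x\<bar> - K) 0" k] int by simp
  also have "\<dots> \<le> (\<Sum>i\<le>grid_size k. \<integral>\<omega>. indicator (grid_event k i) \<omega> * max (\<bar>M (real (Suc N)) \<omega>\<bar> - K) 0 \<partial>P)"
    using K grid_time_le by (intro sum_mono abs_excess_submartingale grid_event_sets) auto
  also have "\<dots> = (\<integral>\<omega>. (\<Sum>i\<le>grid_size k. indicator (grid_event k i) \<omega> * max (\<bar>M (real (Suc N)) \<omega>\<bar> - K) 0) \<partial>P)"
    by (rule Bochner_Integration.integral_sum[symmetric]) (rule int')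
  also have "\<dots> = (\<integral>\<omega>. max (\<bar>M (real (Suc N)) \<omega>\<bar> - K) 0 \<partial>P)"
    by (intro Bochner_Integration.integral_cong refl sum_grid_event)
  finally show ?thesis .
qed

text \<open>Path continuity gives convergence along the grid at every point; the excess bound by the
  fixed variable \<open>M (real (Suc N))\<close> turns it into convergence in L1.\<close>

lemma integrable_stopped: "integrable P (\<lambda>\<omega>. M (T \<omega>) \<omega>)"
  and upper_grid_L1: "(\<lambda>k. \<integral>\<omega>. \<bar>M (upper_grid T k \<omega>) \<omega> - M (T \<omega>) \<omega>\<bar> \<partial>P) \<longlonglongrightarrow> 0"
  using tendsto_L1_uniformly_integrable[of "\<lambda>k \<omega>. M (upper_grid T k \<omega>) \<omega>" "M (real (Suc N))" "\<lambda>\<omega>. M (T \<omega>) \<omega>"]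
    integrable_upper_grid integrable_M path_upper_grid abs_excess_upper_grid by auto

lemma measurable_grid_part:
  assumes f: "f \<in> borel_measurable (pre_sigma T)"
  shows "(\<lambda>\<omega>. indicator (grid_event k i) \<omega> * f \<omega> :: real) \<in> borel_measurable (F (grid_time k i))"
proof -
  have "(\<lambda>\<omega>. indicator (grid_event k i) \<omega> * (if T \<omega> \<le> grid_time k i then f \<omega> else 0)) \<in>
      borel_measurable (F (grid_time k i))"
    using grid_event_sets borel_measurable_pre_sigma_stopped[OF stopping f] by measurable
  also have "(\<lambda>\<omega>. indicator (grid_event k i) \<omega> * (if T \<omega> \<le> grid_time k i then f \<omega> else 0)) =
      (\<lambda>\<omega>. indicator (grid_event k i) \<omega> * f \<omega>)"
    by (auto simp: fun_eq_iff indicator_def grid_event_eq)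
  finally show ?thesis .
qed

lemma pre_sigma_measurable_P:
  fixes f :: "'a \<Rightarrow> real"
  assumes "f \<in> borel_measurable (pre_sigma T)"
  shows "f \<in> borel_measurable P"
proof -
  have "(\<lambda>\<omega>. if T \<omega> \<le> real N then f \<omega> else 0 :: real) \<in> borel_measurable P"
    using borel_measurable_pre_sigma_stopped[OF stopping assms] by (rule measurable_F_P)
  then show ?thesis
    by (subst measurable_cong[where g="\<lambda>\<omega>. if T \<omega> \<le> real N then f \<omega> else 0"]) (use T_le in auto)
qed

text \<open>On a grid event \<open>T\<close> lies below the grid time, so f is measurable at that
  time and the martingale property moves \<open>M\<close> to the terminal time. The identity is
  therefore exact for each k, and only passing from the grid to \<open>T\<close> needs the L1
  limit.\<close>

lemma optional_sampling:
  assumes f: "f \<in> borel_measurable (pre_sigma T)" and bound: "\<And>\<omega>. \<omega> \<in> space P \<Longrightarrow> \<bar>f \<omega>\<bar> \<le> C"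
  shows "(\<integral>\<omega>. f \<omega> * M (T \<omega>) \<omega> \<partial>P) = (\<integral>\<omega>. f \<omega> * M (real (Suc N)) \<omega> \<partial>P)"
proof -
  note fP = pre_sigma_measurable_P[OF f]
  have int: "integrable P (\<lambda>\<omega>. f \<omega> * M t \<omega>)" if "0 \<le> t" for t
    using that by (intro integrable_bounded_mult[OF fP bound] integrable_M)
  have int': "integrable P (\<lambda>\<omega>. indicator (grid_event k i) \<omega> * (f \<omega> * M (real (Suc N)) \<omega>))" for k i
    by (intro integrable_bounded_mult[OF _ _ int, where C=1]) (auto simp: indicator_def)
  have "(\<integral>\<omega>. f \<omega> * M (upper_grid T k \<omega>) \<omega> \<partial>P) = (\<integral>\<omega>. f \<omega> * M (real (Suc N)) \<omega> \<partial>P)" for k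
  proof -
    have "(\<integral>\<omega>. f \<omega> * M (upper_grid T k \<omega>) \<omega> \<partial>P) =
      (\<Sum>i\<le>grid_size k. \<integral>\<omega>. indicator (grid_event k i) \<omega> * (f \<omega> * M (grid_time k i) \<omega>) \<partial>P)"
      using integral_upper_grid(2)[OF fP, of "\<lambda>x. x" k] int by simp
    also have "\<dots> = (\<Sum>i\<le>grid_size k. \<integral>\<omega>. indicator (grid_event k i) \<omega> * (f \<omega> * M (real (Suc N)) \<omega>) \<partial>P)"
    proof (rule sum.cong[OF refl])
      fix i assume "i \<in> {..grid_size k}"
      then have "(\<integral>\<omega>. (indicator (grid_event k i) \<omega> * f \<omega>) * M (real (Suc N)) \<omega> \<partial>P) =
          (\<integral>\<omega>. (indicator (grid_event k i) \<omega> * f \<omega>) * M (grid_time k i) \<omega> \<partial>P)"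
        using grid_time_le measurable_grid_part[OF f] bound
        by (intro martingale_integral[where C="\<bar>C\<bar>"])
           (auto simp: indicator_def abs_mult intro: order_trans[OF _ abs_ge_self])
      then show "(\<integral>\<omega>. indicator (grid_event k i) \<omega> * (f \<omega> * M (grid_time k i) \<omega>) \<partial>P) =
          (\<integral>\<omega>. indicator (grid_event k i) \<omega> * (f \<omega> * M (real (Suc N)) \<omega>) \<partial>P)"
        by (simp add: mult.assoc)
    qed
    also have "\<dots> = (\<integral>\<omega>. (\<Sum>i\<le>grid_size k. indicator (grid_event k i) \<omega> * (f \<omega> * M (real (Suc N)) \<omega>)) \<partial>P)"
      by (rule Bochner_Integration.integral_sum[symmetric]) (rule int')
    also have "\<dots> = (\<integral>\<omega>. f \<omega> * M (real (Suc N)) \<omega> \<partial>P)"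
      by (intro Bochner_Integration.integral_cong refl sum_grid_event)
    finally show ?thesis .
  qed
  then have "(\<lambda>k. \<integral>\<omega>. f \<omega> * M (real (Suc N)) \<omega> \<partial>P) \<longlonglongrightarrow> (\<integral>\<omega>. f \<omega> * M (T \<omega>) \<omega> \<partial>P)"
    using tendsto_integral_mult_L1[OF integrable_upper_grid integrable_stopped upper_grid_L1 fP bound] by simp
  then show ?thesis
    using LIMSEQ_unique tendsto_const by blast
qed

end

section \<open>Positivity on intervals and the first zero\<close>

context filtered_continuous_martingale
begin

definition pos :: "real \<Rightarrow> real \<Rightarrow> 'a set" where
  "pos s t = {\<omega>\<in>space P. \<forall>u\<in>{s..t}. 0 < M u \<omega>}"

text \<open>By compactness a path positive on the interval is bounded below there by some 1/(k+1),
  and by continuity this bound may be tested on a countable dense set. Mere positivity on the dense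
  set would overlook isolated zeros.\<close>

lemma pos_sets:
  assumes st: "0 \<le> s" "s \<le> t"
  shows "pos s t \<in> sets (F t)"
proof -
  obtain D where D: "countable D" "D \<subseteq> {s..t}" "{s..t} \<subseteq> closure D"
    using separable[of "{s..t}"] by metis
  have "D \<noteq> {}" using D st by auto
  have cont: "continuous_on {s..t} (\<lambda>u. M u \<omega>)" if "\<omega> \<in> space P" for \<omega>
    using path[OF that] st by (auto intro: continuous_on_subset)
  have "pos s t = (\<Union>k::nat. \<Inter>q\<in>D. {\<omega>\<in>space P. 1 / real (Suc k) \<le> M q \<omega>})"
  proof (intro equalityI subsetI)
    fix \<omega> assume \<omega>: "\<omega> \<in> pos s t"
    then have sp: "\<omega> \<in> space P" by (simp add: pos_def)
    obtain v where v: "v \<in> {s..t}" "\<And>u. u \<in> {s..t} \<Longrightarrow> M v \<omega> \<le> M u \<omega>"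
      using continuous_attains_inf[OF compact_Icc _ cont[OF sp]] st by fastforce
    have "0 < M v \<omega>" using \<omega> v by (simp add: pos_def)
    then obtain k where "inverse (real (Suc k)) < M v \<omega>" using reals_Archimedean by blast
    then have "\<forall>q\<in>D. 1 / real (Suc k) \<le> M q \<omega>"
      using v D(2) by (force simp: inverse_eq_divide)
    then show "\<omega> \<in> (\<Union>k::nat. \<Inter>q\<in>D. {\<omega>\<in>space P. 1 / real (Suc k) \<le> M q \<omega>})"
      using sp by auto
  next
    fix \<omega> assume "\<omega> \<in> (\<Union>k::nat. \<Inter>q\<in>D. {\<omega>\<in>space P. 1 / real (Suc k) \<le> M q \<omega>})"
    then obtain k :: nat where k: "\<And>q. q \<in> D \<Longrightarrow> \<omega> \<in> space P \<and> 1 / real (Suc k) \<le> M q \<omega>"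
      by auto
    then have sp: "\<omega> \<in> space P" using \<open>D \<noteq> {}\<close> by auto
    have "closed ({s..t} \<inter> (\<lambda>u. M u \<omega>) -` {1 / real (Suc k)..})"
      by (intro continuous_closed_preimage cont sp) auto
    moreover have "D \<subseteq> {s..t} \<inter> (\<lambda>u. M u \<omega>) -` {1 / real (Suc k)..}"
      using D k by auto
    ultimately have "{s..t} \<subseteq> {s..t} \<inter> (\<lambda>u. M u \<omega>) -` {1 / real (Suc k)..}"
      using D(3) closure_minimal by blast
    then have "1 / real (Suc k) \<le> M u \<omega>" if "u \<in> {s..t}" for u using that by auto
    moreover have "0 < 1 / real (Suc k)" by simp
    ultimately have "0 < M u \<omega>" if "u \<in> {s..t}" for u
      using that less_le_trans by blast
    then show "\<omega> \<in> pos s t" using sp by (simp add: pos_def)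
  qed
  also have "\<dots> \<in> sets (F t)"
  proof (intro sets.countable_UN sets.countable_INT' D \<open>D \<noteq> {}\<close> subsetI)
    fix B k assume "B \<in> range (\<lambda>k::nat. \<Inter>q\<in>D. {\<omega>\<in>space P. 1 / real (Suc k) \<le> M q \<omega>})"
    then obtain k where B: "B = (\<Inter>q\<in>D. {\<omega>\<in>space P. 1 / real (Suc k) \<le> M q \<omega>})" by auto
    have "{\<omega>\<in>space P. 1 / real (Suc k) \<le> M q \<omega>} \<in> sets (F t)" if "q \<in> D" for q
    proof -
      have "M q \<in> borel_measurable (F t)"
      proof (rule measurable_F_mono)
        have "q \<in> {s..t}" using that D(2) by blast
        then show "q \<le> t" "M q \<in> borel_measurable (F q)" using st adapted by auto
      qed
      then have "{\<omega>\<in>space (F t). 1 / real (Suc k) \<le> M q \<omega>} \<in> sets (F t)" by measurable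
      then show ?thesis by (simp add: space_F)
    qed
    then show "B \<in> sets (F t)"
      unfolding B by (intro sets.countable_INT' D \<open>D \<noteq> {}\<close>) auto
  qed
  finally show ?thesis .
qed

lemma pos_P: "0 \<le> s \<Longrightarrow> s \<le> t \<Longrightarrow> pos s t \<in> sets P"
  using pos_sets sets_F_le by blast

lemma pos_split: "s \<le> t \<Longrightarrow> t \<le> u \<Longrightarrow> pos s u = pos s t \<inter> pos t u"
  by (force simp: pos_def)

text \<open>The condition is \<open>M \<le> 0\<close> rather than \<open>M = 0\<close>, so that its
  failure on the whole interval is exactly \<open>pos\<close>; by \<open>hit_zero\<close> there is
  no difference when the path starts positive. The value t on \<open>pos\<close> keeps the time
  bounded.\<close>

definition hit :: "real \<Rightarrow> real \<Rightarrow> 'a \<Rightarrow> real" where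
  "hit s t \<omega> = (if \<omega> \<in> pos s t then t else Inf {v\<in>{s..t}. M v \<omega> \<le> 0})"

lemma hit_attained:
  assumes "0 \<le> s" "\<omega> \<in> space P" "\<omega> \<notin> pos s t"
  shows "hit s t \<omega> \<in> {v\<in>{s..t}. M v \<omega> \<le> 0}"
    and "v \<in> {s..t} \<Longrightarrow> M v \<omega> \<le> 0 \<Longrightarrow> hit s t \<omega> \<le> v"
proof -
  let ?Z = "{v\<in>{s..t}. M v \<omega> \<le> 0}"
  have "continuous_on {s..t} (\<lambda>u. M u \<omega>)"
    using path[of \<omega>] assms by (auto intro: continuous_on_subset)
  then have "closed ({s..t} \<inter> (\<lambda>u. M u \<omega>) -` {..0})"
    by (intro continuous_closed_preimage) auto
  moreover have "?Z = {s..t} \<inter> (\<lambda>u. M u \<omega>) -` {..0}" by auto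
  ultimately have "closed ?Z" by simp
  moreover have ne: "?Z \<noteq> {}" using assms by (auto simp: pos_def not_less)
  moreover have bdd: "bdd_below ?Z" by (rule bdd_belowI[of _ s]) auto
  ultimately have "Inf ?Z \<in> ?Z" by (intro closed_contains_Inf) auto
  then show "hit s t \<omega> \<in> ?Z" using assms by (simp add: hit_def)
  show "v \<in> {s..t} \<Longrightarrow> M v \<omega> \<le> 0 \<Longrightarrow> hit s t \<omega> \<le> v"
    using assms bdd by (auto simp: hit_def intro!: cInf_lower)
qed

lemma hit_bounds:
  assumes "0 \<le> s" "s \<le> t" "\<omega> \<in> space P"
  shows "s \<le> hit s t \<omega>" "hit s t \<omega> \<le> t"
  using hit_attained(1)[of s \<omega> t] assms by (cases "\<omega> \<in> pos s t"; auto simp: hit_def)+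

text \<open>The infimum is attained, so for s \<le> u < t the event is precisely the complement of
  \<open>pos s u\<close>, which is decided at time u.\<close>

lemma hit_le_sets:
  assumes st: "0 \<le> s" "s \<le> t"
  shows "{\<omega>\<in>space P. hit s t \<omega> \<le> u} \<in> sets (F u)"
proof -
  consider "u < s" | "s \<le> u" "u < t" | "t \<le> u" by linarith
  then show ?thesis
  proof cases
    case 1
    then have "{\<omega>\<in>space P. hit s t \<omega> \<le> u} = {}" using hit_bounds(1)[OF st] by force
    then show ?thesis by (simp only: sets.empty_sets)
  next
    case 2
    have "{\<omega>\<in>space P. hit s t \<omega> \<le> u} = space P - pos s u"
    proof (intro equalityI subsetI)
      fix \<omega> assume \<omega>: "\<omega> \<in> {\<omega>\<in>space P. hit s t \<omega> \<le> u}"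
      then have "\<omega> \<notin> pos s t" using 2 by (auto simp: hit_def)
      from hit_attained(1)[OF st(1) _ this] \<omega>
      show "\<omega> \<in> space P - pos s u" by (auto simp: pos_def not_less intro!: bexI[of _ "hit s t \<omega>"])
    next
      fix \<omega> assume \<omega>: "\<omega> \<in> space P - pos s u"
      then obtain v where v: "v \<in> {s..u}" "M v \<omega> \<le> 0" by (auto simp: pos_def not_less)
      then have "\<omega> \<notin> pos s t" using 2 by (auto simp: pos_def not_less intro!: bexI[of _ v])
      then have "hit s t \<omega> \<le> v" using hit_attained(2)[OF st(1), of \<omega> t v] v \<omega> 2 by auto
      then show "\<omega> \<in> {\<omega>\<in>space P. hit s t \<omega> \<le> u}" using v \<omega> by auto
    qed
    then show ?thesis using pos_sets[of s u] st 2 space_F[of u] by (metis sets.compl_sets)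
  next
    case 3
    then have "{\<omega>\<in>space P. hit s t \<omega> \<le> u} = space P"
      using hit_bounds(2)[OF st] by force
    then show ?thesis using space_F[of u] by (metis sets.top)
  qed
qed

text \<open>A continuous path cannot jump below 0: the intermediate value theorem gives a zero no
  later than the hitting time, and minimality identifies the two.\<close>

lemma hit_zero:
  assumes "0 \<le> s" "\<omega> \<in> space P" "\<omega> \<notin> pos s t" "0 < M s \<omega>"
  shows "M (hit s t \<omega>) \<omega> = 0"
proof -
  note h = hit_attained[OF assms(1-3)]
  have "continuous_on {s..hit s t \<omega>} (\<lambda>u. M u \<omega>)"
    using path[OF assms(2)] assms(1) by (auto intro: continuous_on_subset)
  then obtain v where "s \<le> v" "v \<le> hit s t \<omega>" "M v \<omega> = 0"
    using IVT2'[of "\<lambda>u. M u \<omega>" "hit s t \<omega>" 0 s] h(1) assms(4) by auto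
  moreover from this have "hit s t \<omega> \<le> v" using h by auto
  ultimately show ?thesis by (metis order_antisym)
qed

text \<open>Optional sampling at the first zero after \<open>s\<close>, where the martingale vanishes.\<close>

lemma integral_pos:
  assumes st: "0 \<le> s" "s \<le> t" and A: "A \<in> sets (F s)"
  shows "(\<integral>\<omega>. indicator (A \<inter> pos s t) \<omega> * M t \<omega> \<partial>P) = (\<integral>\<omega>. indicator A \<omega> * max (M s \<omega>) 0 \<partial>P)"
proof -
  obtain N :: nat where N: "t \<le> real N" using real_arch_simple by blast
  interpret S: bounded_stopping_time P F M "hit s t" N
  proof unfold_locales
    show "stopping_time F (hit s t)"
      using hit_le_sets[OF st] by (auto simp: stopping_time_def pred_def space_F)
    show "0 \<le> hit s t \<omega>" "hit s t \<omega> \<le> real N" if "\<omega> \<in> space P" for \<omega>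
      using hit_bounds[OF st that] st N by auto
  qed
  \<comment> \<open>Where \<open>M s \<le> 0\<close> the hitting time is s and \<open>M\<close> may
    be negative there. Both sides of the claim vanish on this part, so it is removed
    beforehand.\<close>
  define B where "B = {\<omega>\<in>A. 0 < M s \<omega>}"
  have B: "B \<in> sets (F s)"
  proof -
    have [measurable]: "M s \<in> borel_measurable (F s)" using st adapted by simp
    have "B = A \<inter> {\<omega>\<in>space (F s). 0 < M s \<omega>}"
      using A sets.sets_into_space[OF A] by (auto simp: B_def)
    then show ?thesis using A by simp
  qed
  have B_sub: "B \<subseteq> space P" using sets.sets_into_space[OF B] by (simp add: space_F)
  have B_pre: "B \<in> sets (pre_sigma (hit s t))"
  proof (rule sets_pre_sigmaI[OF S.stopping])
    fix u
    have eq: "{\<omega>\<in>B. hit s t \<omega> \<le> u} = B \<inter> {\<omega>\<in>space P. hit s t \<omega> \<le> u}" using B_sub by auto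
    show "{\<omega>\<in>B. hit s t \<omega> \<le> u} \<in> sets (F u)"
    proof (cases "s \<le> u")
      case True
      then show ?thesis
        unfolding eq using B sets_F_mono[of s u] hit_le_sets[OF st] by auto
    next
      case False
      then have "{\<omega>\<in>B. hit s t \<omega> \<le> u} = {}"
        using hit_bounds(1)[OF st] B_sub by force
      then show ?thesis by (simp only: sets.empty_sets)
    qed
  qed
  have "(\<integral>\<omega>. indicator (A \<inter> pos s t) \<omega> * M t \<omega> \<partial>P) = (\<integral>\<omega>. indicator B \<omega> * M (hit s t \<omega>) \<omega> \<partial>P)"
  proof (rule Bochner_Integration.integral_cong[OF refl])
    fix \<omega> assume \<omega>: "\<omega> \<in> space P"
    show "indicator (A \<inter> pos s t) \<omega> * M t \<omega> = indicator B \<omega> * M (hit s t \<omega>) \<omega>"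
    proof (cases "\<omega> \<in> pos s t")
      case True
      then have "0 < M s \<omega>" using st by (auto simp: pos_def)
      with True show ?thesis by (auto simp: indicator_def B_def hit_def)
    next
      case False
      then show ?thesis using hit_zero[OF st(1) \<omega> False] by (auto simp: indicator_def B_def)
    qed
  qed
  \<comment> \<open>The hitting time and s are compared through the common terminal time.\<close>
  also have "\<dots> = (\<integral>\<omega>. indicator B \<omega> * M (real (Suc N)) \<omega> \<partial>P)"
    using B_pre by (intro S.optional_sampling[where C=1]) (auto simp: indicator_def)
  also have "\<dots> = (\<integral>\<omega>. indicator B \<omega> * M s \<omega> \<partial>P)"
    using st N B by (intro martingale_indicator) auto
  also have "\<dots> = (\<integral>\<omega>. indicator A \<omega> * max (M s \<omega>) 0 \<partial>P)"
    by (intro Bochner_Integration.integral_cong) (auto simp: B_def indicator_def)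
  finally show ?thesis .
qed

end

section \<open>Construction of the associated measure\<close>

text \<open>The last two conclusions interlace \<open>G\<close> with \<open>F\<close>, because
  \<open>F t\<close> is the intersection of the later \<open>G s\<close>. They let martingale
  identities, known on \<open>F\<close>, serve as consistency on \<open>G\<close>, and let a measure
  known on \<open>G\<close> be evaluated on every \<open>F t\<close>.\<close>

lemma property_P_generating_sequence:
  assumes "property_P P F"
  obtains G :: "nat \<Rightarrow> 'a measure"
  where "\<And>n. space (G n) = space P"
    and "\<And>m n. m \<le> n \<Longrightarrow> sets (G m) \<subseteq> sets (G n)"
    and "\<And>n. polish_generated (G n)"
    and "\<And>\<omega> :: nat \<Rightarrow> 'a. range \<omega> \<subseteq> space P \<Longrightarrow>
      (\<And>N. (\<Inter>n\<le>N. atom_of (G n) (\<omega> n)) \<noteq> {}) \<Longrightarrow> (\<Inter>n. atom_of (G n) (\<omega> n)) \<noteq> {}"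
    and "\<And>n. sets (G n) \<subseteq> sets (F (real n))"
    and "\<And>t n. 0 \<le> t \<Longrightarrow> t < real n \<Longrightarrow> sets (F t) \<subseteq> sets (G n)"
proof -
  from assms obtain G :: "real \<Rightarrow> 'a measure" where
    filt: "filtration (space P) G"
    and FG: "\<forall>t\<ge>0. sets (F t) = (\<Inter>s\<in>{t<..}. sets (G s))"
    and pol: "\<forall>t\<ge>0. polish_generated (G t)"
    and atoms: "\<forall>\<omega> :: nat \<Rightarrow> 'a. range \<omega> \<subseteq> space P \<longrightarrow>
           (\<forall>N. (\<Inter>n\<le>N. atom_of (G (real n)) (\<omega> n)) \<noteq> {}) \<longrightarrow>
           (\<Inter>n. atom_of (G (real n)) (\<omega> n)) \<noteq> {}"
    unfolding property_P_def by (elim exE conjE) rule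
  interpret G: filtration "space P" G by (rule filt)
  show ?thesis
  proof (rule that[of "\<lambda>n. G (real n)"])
    show "sets (G (real n)) \<subseteq> sets (F (real n))" for n
    proof -
      have "sets (F (real n)) = (\<Inter>s\<in>{real n<..}. sets (G s))" using FG by simp
      then show ?thesis using G.sets_F_mono[of "real n"] by (auto intro: less_imp_le)
    qed
    show "sets (F t) \<subseteq> sets (G (real n))" if "0 \<le> t" "t < real n" for t n
      using FG that by auto
    show "(\<Inter>n. atom_of (G (real n)) (\<omega> n)) \<noteq> {}"
      if "range \<omega> \<subseteq> space P" "\<And>N. (\<Inter>n\<le>N. atom_of (G (real n)) (\<omega> n)) \<noteq> {}" for \<omega> :: "nat \<Rightarrow> 'a"
      using atoms that by blast
  qed (use pol G.sets_F_mono in \<open>simp_all add: G.space_F\<close>)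
qed

section \<open>Measures carried by the paths that stay positive from time n on\<close>

locale property_P_martingale = filtered_continuous_martingale +
  assumes property_P: "property_P P F"
begin

lemma sets_P: "sets P = sigma_sets (space P) (\<Union>t\<in>{0..}. sets (F t))"
  using property_P by (simp add: property_P_def)

text \<open>The sets known at some integer time from n on form a generating family stable under
  intersection. Starting at n matters, as the masses below are consistent only from their starting
  time on.\<close>

lemma eq_measure_if_eq_on_F:
  fixes n :: nat
  assumes "sets \<mu> = sets P" "sets \<nu> = sets P" "emeasure \<mu> (space P) \<noteq> \<infinity>"
    and eq: "\<And>k A. n \<le> k \<Longrightarrow> A \<in> sets (F (real k)) \<Longrightarrow> emeasure \<mu> A = emeasure \<nu> A"
  shows "\<mu> = \<nu>"
proof -
  let ?E = "\<Union>k\<in>{n..}. sets (F (real k))"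
  have "?E \<subseteq> (\<Union>t\<in>{0..}. sets (F t))" by (intro UN_least UN_upper) simp
  moreover have "(\<Union>t\<in>{0..}. sets (F t)) \<subseteq> ?E"
  proof
    fix A assume "A \<in> (\<Union>t\<in>{0..}. sets (F t))"
    then obtain t where "A \<in> sets (F t)" "0 \<le> t" by auto
    moreover obtain k :: nat where "t \<le> real k" using real_arch_simple by blast
    moreover from this have "t \<le> real (max k n)" by simp
    ultimately have "A \<in> sets (F (real (max k n)))"
      using sets_F_mono by blast
    then show "A \<in> ?E" by (intro UN_I[of "max k n"]) auto
  qed
  ultimately have P: "sets P = sigma_sets (space P) ?E" using sets_P by simp
  show ?thesis
  proof (rule measure_eqI_generator_eq[where E="?E" and A="\<lambda>_. space P"])
    show "Int_stable ?E"
    proof (rule Int_stableI)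
      fix A B assume "A \<in> ?E" "B \<in> ?E"
      then obtain k l where kl: "n \<le> k" "A \<in> sets (F (real k))" "n \<le> l" "B \<in> sets (F (real l))" by auto
      then have "A \<inter> B \<in> sets (F (real (max k l)))"
        using sets_F_mono[of "real k" "real (max k l)"] sets_F_mono[of "real l" "real (max k l)"] by auto
      then show "A \<inter> B \<in> ?E" using kl by (intro UN_I[of "max k l"]) auto
    qed
    show "?E \<subseteq> Pow (space P)" using sets.sets_into_space space_F by blast
    have "space P \<in> sets (F (real n))" using sets.top[of "F (real n)"] by (simp add: space_F)
    then show "range (\<lambda>_. space P) \<subseteq> ?E" by auto
  qed (use assms P eq in auto)
qed

text \<open>For \<open>A\<close> in \<open>F t\<close> and 0 \<le> s \<le> t this is the value that
  an associated measure must give to the part of \<open>A\<close> where the path stays positive from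
  s on forever; see \<open>associated_measure_tail_pos\<close> for integer s.\<close>

definition mass :: "real \<Rightarrow> real \<Rightarrow> 'a set \<Rightarrow> real" where
  "mass s t A = (\<integral>\<omega>. indicator (A \<inter> pos s t) \<omega> * M t \<omega> \<partial>P)"

text \<open>Positivity up to u splits at t. The part up to t is an event of \<open>F t\<close> on
  which the positive part of \<open>M t\<close> is \<open>M t\<close>, so
  \<open>integral_pos\<close> removes the rest.\<close>

lemma mass_consistent:
  assumes "0 \<le> s" "s \<le> t" "t \<le> u" and A: "A \<in> sets (F t)"
  shows "mass s u A = mass s t A"
proof -
  have "mass s u A = (\<integral>\<omega>. indicator ((A \<inter> pos s t) \<inter> pos t u) \<omega> * M u \<omega> \<partial>P)"
    unfolding mass_def pos_split[OF assms(2,3)] by (simp add: Int_assoc)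
  also have "\<dots> = (\<integral>\<omega>. indicator (A \<inter> pos s t) \<omega> * max (M t \<omega>) 0 \<partial>P)"
    using assms pos_sets[of s t] by (intro integral_pos) auto
  also have "\<dots> = mass s t A"
    unfolding mass_def
  proof (rule Bochner_Integration.integral_cong[OF refl])
    fix \<omega>
    have "0 < M t \<omega>" if "\<omega> \<in> pos s t" using that assms by (auto simp: pos_def)
    then show "indicator (A \<inter> pos s t) \<omega> * max (M t \<omega>) 0 = indicator (A \<inter> pos s t) \<omega> * M t \<omega>"
      by (auto simp: indicator_def max_def)
  qed
  finally show ?thesis .
qed

lemma emeasure_density_mass:
  assumes "0 \<le> s" "s \<le> t" and A: "A \<in> sets P"
  shows "emeasure (density P (\<lambda>\<omega>. ennreal (indicator (pos s t) \<omega> * M t \<omega>))) A = ennreal (mass s t A)"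
proof -
  have [measurable]: "M t \<in> borel_measurable P" "pos s t \<in> sets P"
    using assms measurable_M pos_P by auto
  have "emeasure (density P (\<lambda>\<omega>. ennreal (indicator (pos s t) \<omega> * M t \<omega>))) A =
      (\<integral>\<^sup>+\<omega>. ennreal (indicator (pos s t) \<omega> * M t \<omega>) * indicator A \<omega> \<partial>P)"
    using A by (intro emeasure_density) measurable
  also have "\<dots> = (\<integral>\<^sup>+\<omega>. ennreal (indicator (A \<inter> pos s t) \<omega> * M t \<omega>) \<partial>P)"
    by (intro nn_integral_cong) (auto simp: indicator_def)
  also have "\<dots> = ennreal (mass s t A)"
    unfolding mass_def
  proof (rule nn_integral_eq_integral)
    show "integrable P (\<lambda>\<omega>. indicator (A \<inter> pos s t) \<omega> * M t \<omega>)"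
      using assms by (intro integrable_bounded_mult[where C=1] integrable_M) (auto simp: indicator_def)
    show "AE \<omega> in P. 0 \<le> indicator (A \<inter> pos s t) \<omega> * M t \<omega>"
      using assms by (intro AE_I2) (auto simp: indicator_def pos_def intro: less_imp_le)
  qed
  finally show ?thesis .
qed

lemma mass_nonneg: "s \<le> t \<Longrightarrow> 0 \<le> mass s t A"
  unfolding mass_def
  by (rule integral_nonneg_AE, intro AE_I2) (auto simp: indicator_def pos_def intro: less_imp_le)

lemma mass_extension:
  "\<exists>Q. sets Q = sets P \<and>
    (\<forall>t\<ge>real n. \<forall>A\<in>sets (F t). emeasure Q A = ennreal (mass (real n) t A))"
\<comment> \<open>Kolmogorov's theorem is about probability measures, so one divides by the total
  mass. If it is 0, it is 0 at all later times as well and the null measure serves.\<close>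
proof (cases "mass n n (space P) = 0")
  case True
  have "emeasure (null_measure P) A = ennreal (mass n t A)" if t: "real n \<le> t" and A: "A \<in> sets (F t)" for t A
  proof -
    have "space P \<in> sets (F (real n))" using sets.top[of "F (real n)"] by (simp add: space_F)
    then have "mass n t (space P) = 0"
      using True t mass_consistent[of "real n" "real n" t "space P"] by simp
    then have *: "emeasure (density P (\<lambda>\<omega>. ennreal (indicator (pos n t) \<omega> * M t \<omega>))) (space P) = 0"
      using t emeasure_density_mass[of "real n" t "space P"] by simp
    have AP: "A \<in> sets P" using A sets_F_le by blast
    have "ennreal (mass n t A) = emeasure (density P (\<lambda>\<omega>. ennreal (indicator (pos n t) \<omega> * M t \<omega>))) A"
      using t AP emeasure_density_mass[of "real n" t A] by simp
    also have "\<dots> \<le> emeasure (density P (\<lambda>\<omega>. ennreal (indicator (pos n t) \<omega> * M t \<omega>))) (space P)"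
      by (rule emeasure_mono) (use AP sets.sets_into_space in auto)
    finally show ?thesis using * by simp
  qed
  then show ?thesis by (intro exI[of _ "null_measure P"]) auto
next
  case False
  define c where "c = mass n n (space P)"
  have c: "0 < c" using False mass_nonneg[of "real n" "real n" "space P"] by (simp add: c_def)
  obtain G :: "nat \<Rightarrow> 'a measure" where space_G: "\<And>n. space (G n) = space P"
    and mono_G: "\<And>m n. m \<le> n \<Longrightarrow> sets (G m) \<subseteq> sets (G n)"
    and pol: "\<And>n. polish_generated (G n)"
    and atoms: "\<And>\<omega> :: nat \<Rightarrow> 'a. range \<omega> \<subseteq> space P \<Longrightarrow>
      (\<And>N. (\<Inter>n\<le>N. atom_of (G n) (\<omega> n)) \<noteq> {}) \<Longrightarrow> (\<Inter>n. atom_of (G n) (\<omega> n)) \<noteq> {}"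
    and GF: "\<And>n. sets (G n) \<subseteq> sets (F (real n))"
    and FG: "\<And>t n. 0 \<le> t \<Longrightarrow> t < real n \<Longrightarrow> sets (F t) \<subseteq> sets (G n)"
    using property_P_generating_sequence[OF property_P] by blast
  \<comment> \<open>Levels j below n use the density at time n, since the masses are defined
    consistently only from n on.\<close>
  define t where "t j = real (max n j)" for j
  define \<mu> where "\<mu> j = density P (\<lambda>\<omega>. ennreal (indicator (pos n (t j)) \<omega> * M (t j) \<omega>))" for j
  define \<nu> where "\<nu> j = scale_measure (ennreal (1/c)) (restr_to_subalg (\<mu> j) (G j))" for j
  have G_P: "sets (G j) \<subseteq> sets P" for j using GF sets_F_le by blast
  have sub: "subalgebra (\<mu> j) (G j)" for j
    using G_P by (simp add: subalgebra_def \<mu>_def space_G)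
  have \<nu>: "emeasure (\<nu> j) A = ennreal (1/c) * ennreal (mass n (t j) A)" if "A \<in> sets (G j)" for j A
  proof -
    have "A \<in> sets P" using that G_P by blast
    then show ?thesis
      using emeasure_restr_to_subalg[OF sub that] emeasure_density_mass[of "real n" "t j" A]
      by (simp add: \<nu>_def \<mu>_def t_def)
  qed
  have cc: "ennreal (1/c) * ennreal c = 1" using c by (simp add: ennreal_mult[symmetric])
  have space_FS: "space P \<in> sets (F s)" for s using sets.top[of "F s"] by (simp add: space_F)
  have "\<exists>Q. sets Q = sigma_sets (space P) (\<Union>j. sets (G j)) \<and>
    (\<forall>j. \<forall>A\<in>sets (G j). emeasure Q A = emeasure (\<nu> j) A)"
  proof (rule projective_extension[OF space_G mono_G pol atoms])
    show sets_\<nu>: "sets (\<nu> j) = sets (G j)" for j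
      using sub by (simp add: \<nu>_def sets_restr_to_subalg)
    show "prob_space (\<nu> j)" for j
    proof
      have sp: "space (\<nu> j) = space P"
        using sets_eq_imp_space_eq[OF sets_\<nu>] by (simp add: space_G)
      have "space P \<in> sets (G j)" using sets.top[of "G j"] by (simp add: space_G)
      then have "emeasure (\<nu> j) (space P) = ennreal (1/c) * ennreal (mass n (t j) (space P))"
        by (rule \<nu>)
      also have "mass n (t j) (space P) = c"
        unfolding c_def using space_FS by (intro mass_consistent) (auto simp: t_def)
      finally show "emeasure (\<nu> j) (space (\<nu> j)) = 1" using sp cc by simp
    qed
    show "emeasure (\<nu> (Suc j)) A = emeasure (\<nu> j) A" if A: "A \<in> sets (G j)" for j A
    proof -
      have "A \<in> sets (F (t j))" using A GF[of j] sets_F_mono[of "real j" "t j"] by (auto simp: t_def)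
      then have "mass n (t (Suc j)) A = mass n (t j) A"
        by (intro mass_consistent) (auto simp: t_def)
      moreover have "A \<in> sets (G (Suc j))" using A mono_G[of j "Suc j"] by auto
      ultimately show ?thesis using \<nu> A by simp
    qed
  qed
  then obtain Q where Q: "sets Q = sigma_sets (space P) (\<Union>j. sets (G j))"
    "\<And>j A. A \<in> sets (G j) \<Longrightarrow> emeasure Q A = emeasure (\<nu> j) A" by blast
  have "(\<Union>j. sets (G j)) = (\<Union>t\<in>{0..}. sets (F t))"
  proof (intro equalityI subsetI)
    fix A assume "A \<in> (\<Union>j. sets (G j))"
    then obtain j where "A \<in> sets (F (real j))" using GF by auto
    then show "A \<in> (\<Union>t\<in>{0..}. sets (F t))" by (intro UN_I[of "real j"]) auto
  next
    fix A assume "A \<in> (\<Union>t\<in>{0..}. sets (F t))"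
    then obtain s where s: "0 \<le> s" "A \<in> sets (F s)" by auto
    obtain j :: nat where "s < real j" using reals_Archimedean2 by blast
    then show "A \<in> (\<Union>j. sets (G j))" using FG[of s j] s by auto
  qed
  then have sets_Q: "sets Q = sets P" using Q(1) sets_P by simp
  have "emeasure (scale_measure (ennreal c) Q) A = ennreal (mass n s A)"
    if s: "real n \<le> s" and A: "A \<in> sets (F s)" for s A
  proof -
    \<comment> \<open>A level strictly beyond s is required for \<open>F s\<close> to be contained
      in \<open>G j\<close>.\<close>
    obtain j :: nat where j: "s < real j" using reals_Archimedean2 by blast
    then have "A \<in> sets (G j)" using FG[of s j] s A by auto
    then have "emeasure (scale_measure (ennreal c) Q) A = ennreal c * (ennreal (1/c) * ennreal (mass n (t j) A))"
      using Q(2) \<nu> by simp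
    also have "\<dots> = ennreal (mass n (t j) A)"
      using cc by (simp add: mult.assoc[symmetric] mult.commute)
    also have "mass n (t j) A = mass n s A"
      using s A j by (intro mass_consistent) (auto simp: t_def)
    finally show ?thesis .
  qed
  then show ?thesis using sets_Q by (intro exI[of _ "scale_measure (ennreal c) Q"]) auto
qed

text \<open>The prescribed values determine the measure by \<open>eq_measure_if_eq_on_F\<close>, so
  the choice is no real one.\<close>

definition mass_measure :: "nat \<Rightarrow> 'a measure" where
  "mass_measure n = (SOME Q. sets Q = sets P \<and>
    (\<forall>t\<ge>real n. \<forall>A\<in>sets (F t). emeasure Q A = ennreal (mass (real n) t A)))"

lemma sets_mass_measure[simp]: "sets (mass_measure n) = sets P"
  and emeasure_mass_measure:
    "real n \<le> t \<Longrightarrow> A \<in> sets (F t) \<Longrightarrow> emeasure (mass_measure n) A = ennreal (mass (real n) t A)"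
  using someI_ex[OF mass_extension[of n]] unfolding mass_measure_def[symmetric] by auto

lemma space_mass_measure[simp]: "space (mass_measure n) = space P"
  by (rule sets_eq_imp_space_eq) simp

lemma space_F_sets: "space P \<in> sets (F t)"
  using sets.top[of "F t"] by (simp add: space_F)

lemma finite_mass_measure: "finite_measure (mass_measure n)"
  using emeasure_mass_measure[OF order_refl space_F_sets, of n] by (intro finite_measureI) simp

section \<open>Gluing along the tail events\<close>

definition tail_pos :: "real \<Rightarrow> 'a set" where
  "tail_pos t = {\<omega>\<in>space P. \<forall>u\<ge>t. 0 < M u \<omega>}"

lemma tail_pos_eq: "tail_pos t = (\<Inter>k::nat. pos t (t + real k))"
proof (intro equalityI subsetI)
  fix \<omega> assume \<omega>: "\<omega> \<in> (\<Inter>k::nat. pos t (t + real k))"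
  have "0 < M u \<omega>" if "t \<le> u" for u
  proof -
    obtain k :: nat where "u - t \<le> real k" using real_arch_simple by blast
    then have "u \<in> {t..t + real k}" using that by auto
    then show ?thesis using \<omega> by (auto simp: pos_def)
  qed
  then show "\<omega> \<in> tail_pos t" using \<omega> by (auto simp: tail_pos_def pos_def)
qed (auto simp: tail_pos_def pos_def)

lemma tail_pos_sets[measurable]: "0 \<le> t \<Longrightarrow> tail_pos t \<in> sets P"
  unfolding tail_pos_eq using pos_P by (intro sets.countable_INT) auto

lemma tail_pos_mono: "s \<le> t \<Longrightarrow> tail_pos s \<subseteq> tail_pos t"
  by (auto simp: tail_pos_def)

lemma tail_pos_split: "s \<le> t \<Longrightarrow> tail_pos s = pos s t \<inter> tail_pos t"
  by (force simp: tail_pos_def pos_def)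

text \<open>At each horizon n + k the density contains the indicator of \<open>pos\<close>, so its
  complement has mass 0; countably many horizons exhaust the tail.\<close>

lemma AE_mass_measure_tail_pos: "AE \<omega> in mass_measure n. \<omega> \<in> tail_pos n"
proof -
  interpret finite_measure "mass_measure n" by (rule finite_mass_measure)
  have "AE \<omega> in mass_measure n. \<omega> \<in> pos n (real n + real k)" for k
  proof (rule AE_I')
    let ?p = "pos n (real n + real k)"
    have p: "?p \<in> sets (F (real n + real k))" by (intro pos_sets) auto
    have "space P - ?p \<in> sets (F (real n + real k))"
      using p space_F_sets by (intro sets.Diff)
    moreover have "mass n (real n + real k) (space P - ?p) = 0"
    proof -
      have "(space P - ?p) \<inter> ?p = {}" by auto
      then show ?thesis by (simp add: mass_def)
    qed
    ultimately have "emeasure (mass_measure n) (space P - ?p) = 0"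
      using emeasure_mass_measure[of n "real n + real k" "space P - ?p"] by simp
    moreover have "space P - ?p \<in> sets P"
      using p sets_F_le by blast
    ultimately show "space P - ?p \<in> null_sets (mass_measure n)"
      by (intro null_setsI) auto
    show "{\<omega> \<in> space (mass_measure n). \<omega> \<notin> ?p} \<subseteq> space P - ?p" by auto
  qed
  then show ?thesis unfolding tail_pos_eq by (simp add: AE_all_countable)
qed

lemma mass_measure_tail_pos:
  assumes "A \<in> sets P"
  shows "emeasure (mass_measure n) (A \<inter> tail_pos n) = emeasure (mass_measure n) A"
  using AE_mass_measure_tail_pos[of n] assms by (intro emeasure_eq_AE) auto

text \<open>The compatibility that permits gluing. On sets known at a time k \<ge> m both sides
  integrate \<open>M k\<close> over positivity from n to k, split at m.\<close>

lemma mass_measure_restrict: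
  assumes nm: "n \<le> m" and A: "A \<in> sets P"
  shows "emeasure (mass_measure n) A = emeasure (mass_measure m) (A \<inter> pos n m)"
proof -
  have p: "pos n m \<in> sets (F (real m))" using nm by (intro pos_sets) auto
  then have pP: "pos n m \<in> sets (mass_measure m)" using sets_F_le by auto
  have d: "emeasure (density (mass_measure m) (indicator (pos n m))) B = emeasure (mass_measure m) (pos n m \<inter> B)"
    if "B \<in> sets P" for B
    using that pP by (intro emeasure_restricted) auto
  have "mass_measure n = density (mass_measure m) (indicator (pos n m))"
  proof (rule eq_measure_if_eq_on_F[where n=m])
    show "emeasure (mass_measure n) (space P) \<noteq> \<infinity>"
      using finite_measure.emeasure_finite[OF finite_mass_measure] by simp
    fix k B assume k: "m \<le> k" and B: "B \<in> sets (F (real k))"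
    have pk: "pos n m \<inter> B \<in> sets (F (real k))"
      using p B sets_F_mono[of "real m" "real k"] k by auto
    have "emeasure (mass_measure m) (pos n m \<inter> B) = ennreal (mass m k (pos n m \<inter> B))"
      using k pk by (intro emeasure_mass_measure) auto
    also have "mass m k (pos n m \<inter> B) = mass n k B"
      unfolding mass_def using pos_split[of "real n" "real m" "real k"] nm k
      by (simp add: Int_ac)
    also have "ennreal \<dots> = emeasure (mass_measure n) B"
      using nm k B by (intro emeasure_mass_measure[symmetric]) auto
    finally show "emeasure (mass_measure n) B = emeasure (density (mass_measure m) (indicator (pos n m))) B"
      using d[of B] B sets_F_le[of "real k"] by (simp add: subset_iff)
  qed auto
  then show ?thesis using d[OF A] by (simp add: Int_commute)
qed

text \<open>Each member of the sequence is a restriction of the later ones, so the sequence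
  increases and the lattice supremum is the setwise one.\<close>

definition limit_measure :: "'a measure" where
  "limit_measure = (SUP n. mass_measure n)"

lemma mass_measure_mono:
  assumes "n \<le> m" "A \<in> sets P"
  shows "emeasure (mass_measure n) A \<le> emeasure (mass_measure m) A"
  unfolding mass_measure_restrict[OF assms] using assms by (intro emeasure_mono) auto

lemma sets_limit_measure[simp]: "sets limit_measure = sets P"
  unfolding limit_measure_def by (rule sets_SUP) simp_all

lemma space_limit_measure[simp]: "space limit_measure = space P"
  by (rule sets_eq_imp_space_eq) simp

lemma emeasure_limit_measure:
  assumes "A \<in> sets P"
  shows "emeasure limit_measure A = (SUP n. emeasure (mass_measure n) A)"
  unfolding limit_measure_def
proof (rule emeasure_SUP_chain)
  have le: "mass_measure n \<le> mass_measure m" if "n \<le> m" for n m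
  proof -
    have "emeasure (mass_measure n) B \<le> emeasure (mass_measure m) B" for B
      using mass_measure_mono[OF that, of B]
      by (cases "B \<in> sets P") (simp_all add: emeasure_notin_sets)
    then show ?thesis by (simp add: le_measure_iff le_fun_def)
  qed
  show "Complete_Partial_Order.chain (\<le>) (range mass_measure)"
  proof (rule chainI)
    fix \<mu> \<nu> assume "\<mu> \<in> range mass_measure" "\<nu> \<in> range mass_measure"
    then obtain m n where "\<mu> = mass_measure m" "\<nu> = mass_measure n" by (elim rangeE)
    then show "\<mu> \<le> \<nu> \<or> \<nu> \<le> \<mu>" using le[of m n] le[of n m] linear[of m n] by (elim disjE) simp_all
  qed
qed (use assms in auto)

text \<open>From index n on the supremum is stationary on these sets, because
  \<open>tail_pos n\<close> lies inside every \<open>pos n m\<close>.\<close>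

lemma limit_measure_tail_pos:
  assumes A: "A \<in> sets P"
  shows "emeasure limit_measure (A \<inter> tail_pos (real n)) = emeasure (mass_measure n) A"
proof -
  have At: "A \<inter> tail_pos (real n) \<in> sets P" using A by simp
  have large: "emeasure (mass_measure m) (A \<inter> tail_pos n) = emeasure (mass_measure n) A" if "n \<le> m" for m
  proof -
    have "A \<inter> tail_pos n \<inter> pos n m = A \<inter> tail_pos n"
      using tail_pos_split[of "real n" "real m"] that by auto
    then show ?thesis
      using mass_measure_restrict[OF that At] mass_measure_tail_pos[OF A] by simp
  qed
  show ?thesis
    unfolding emeasure_limit_measure[OF At]
  proof (rule SUP_eqI)
    fix m
    have "emeasure (mass_measure m) (A \<inter> tail_pos n) \<le> emeasure (mass_measure (max n m)) (A \<inter> tail_pos n)"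
      by (intro mass_measure_mono At) simp
    then show "emeasure (mass_measure m) (A \<inter> tail_pos n) \<le> emeasure (mass_measure n) A"
      using large[of "max n m"] by simp
  next
    fix y assume "\<And>m. m \<in> UNIV \<Longrightarrow> emeasure (mass_measure m) (A \<inter> tail_pos n) \<le> y"
    from this[of n] show "emeasure (mass_measure n) A \<le> y" using large[of n] by simp
  qed
qed

lemma null_sets_limit_measure:
  "space P - (\<Union>n::nat. tail_pos (real n)) \<in> null_sets limit_measure"
proof -
  let ?B = "space P - (\<Union>n::nat. tail_pos (real n))"
  have B: "?B \<in> sets P" by (intro sets.Diff sets.top sets.countable_UN) auto
  have "emeasure (mass_measure m) ?B = 0" for m
  proof -
    have "?B \<inter> tail_pos (real m) = {}" by auto
    then show ?thesis using mass_measure_tail_pos[OF B, of m] by simp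
  qed
  then show ?thesis
    using B by (intro null_setsI) (auto simp: emeasure_limit_measure)
qed

lemma AE_limit_measure: "AE \<omega> in limit_measure. \<exists>n::nat. \<omega> \<in> tail_pos (real n)"
  by (rule AE_I'[OF null_sets_limit_measure]) auto

lemma sigma_finite_limit_measure: "sigma_finite_measure limit_measure"
proof
  let ?B = "space P - (\<Union>n::nat. tail_pos (real n))"
  have B: "?B \<in> sets limit_measure" "emeasure limit_measure ?B = 0"
    using null_sets_limit_measure by (rule null_setsD2, rule null_setsD1)
  have fin: "emeasure limit_measure (tail_pos (real n)) \<noteq> \<infinity>" for n
  proof -
    have "emeasure limit_measure (space P \<inter> tail_pos (real n)) = emeasure (mass_measure n) (space P)"
      by (rule limit_measure_tail_pos) simp
    moreover have "space P \<inter> tail_pos (real n) = tail_pos (real n)" by (auto simp: tail_pos_def)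
    ultimately show ?thesis
      using finite_measure.emeasure_finite[OF finite_mass_measure, of n "space P"] by simp
  qed
  show "\<exists>A. countable A \<and> A \<subseteq> sets limit_measure \<and> \<Union> A = space limit_measure \<and>
      (\<forall>a\<in>A. emeasure limit_measure a \<noteq> \<infinity>)"
  \<comment> \<open>The tail events have finite measure but need not cover the space; the null
    remainder completes the cover.\<close>
  proof (intro exI[of _ "insert ?B (range (\<lambda>n::nat. tail_pos (real n)))"] conjI)
    have "tail_pos (real n) \<subseteq> space P" for n by (auto simp: tail_pos_def)
    then show "\<Union> (insert ?B (range (\<lambda>n::nat. tail_pos (real n)))) = space limit_measure" by auto
  qed (use B fin in auto)
qed

text \<open>Passes from integer to real times: positivity from t to some integer n \<ge> t is an
  event of \<open>F (real n)\<close>, and \<open>integral_pos\<close> carries the resulting integral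
  back to time t.\<close>

lemma emeasure_limit_measure_tail_pos:
  assumes t: "0 \<le> t" and A: "A \<in> sets (F t)"
  shows "emeasure limit_measure (A \<inter> tail_pos t) = ennreal (\<integral>\<omega>. indicator A \<omega> * max (M t \<omega>) 0 \<partial>P)"
proof -
  obtain n :: nat where n: "t \<le> real n" using real_arch_simple by blast
  have An: "A \<inter> pos t n \<in> sets (F (real n))"
    using t n A pos_sets[of t "real n"] sets_F_mono[of t "real n"] by auto
  have "A \<inter> tail_pos t = (A \<inter> pos t n) \<inter> tail_pos (real n)"
    using tail_pos_split[OF n] by auto
  then have "emeasure limit_measure (A \<inter> tail_pos t) = emeasure (mass_measure n) (A \<inter> pos t n)"
    using An sets_F_le limit_measure_tail_pos by (metis subsetD)
  also have "\<dots> = ennreal (mass n n (A \<inter> pos t n))"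
    using An by (intro emeasure_mass_measure) auto
  also have "mass n n (A \<inter> pos t n) = (\<integral>\<omega>. indicator (A \<inter> pos t n) \<omega> * M n \<omega> \<partial>P)"
  proof -
    have "A \<inter> pos t n \<inter> pos n n = A \<inter> pos t n" using n by (auto simp: pos_def)
    then show ?thesis by (simp add: mass_def)
  qed
  also have "\<dots> = (\<integral>\<omega>. indicator A \<omega> * max (M t \<omega>) 0 \<partial>P)"
    using t n A by (rule integral_pos)
  finally show ?thesis .
qed

text \<open>The two density measures differ in general but agree on \<open>F t\<close> by the
  preceding lemma. They are therefore restricted to \<open>F t\<close>, which suffices for
  integrating f.\<close>

lemma integral_limit_measure_tail_pos:
  assumes t: "0 \<le> t" and f: "f \<in> borel_measurable (F t)" and bound: "\<And>\<omega>. \<omega> \<in> space P \<Longrightarrow> \<bar>f \<omega>\<bar> \<le> C"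
  shows "integrable limit_measure (\<lambda>\<omega>. indicator (tail_pos t) \<omega> * f \<omega>)"
    and "(\<integral>\<omega>. indicator (tail_pos t) \<omega> * f \<omega> \<partial>limit_measure) = (\<integral>\<omega>. f \<omega> * max (M t \<omega>) 0 \<partial>P)"
proof -
  let ?Q = "density limit_measure (\<lambda>\<omega>. ennreal (indicator (tail_pos t) \<omega>))"
  let ?R = "density P (\<lambda>\<omega>. ennreal (max (M t \<omega>) 0))"
  have fP[measurable]: "f \<in> borel_measurable P" using f by (rule measurable_F_P)
  have fQ[measurable]: "f \<in> borel_measurable limit_measure"
    using fP measurable_cong_sets[OF sets_limit_measure refl] by blast
  have [measurable]: "M t \<in> borel_measurable P" using t by (rule measurable_M)
  have tp[measurable]: "tail_pos t \<in> sets limit_measure" using t by simp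
  have subQ: "subalgebra ?Q (F t)" and subR: "subalgebra ?R (F t)"
    using sets_F_le by (auto simp: subalgebra_def space_F)
  have "restr_to_subalg ?Q (F t) = restr_to_subalg ?R (F t)"
  proof (rule measure_eqI)
    fix A assume "A \<in> sets (restr_to_subalg ?Q (F t))"
    then have A: "A \<in> sets (F t)" by (simp add: sets_restr_to_subalg[OF subQ])
    then have AP[measurable]: "A \<in> sets P" using sets_F_le by blast
    have "emeasure ?Q A = emeasure limit_measure (A \<inter> tail_pos t)"
    proof -
      have "emeasure ?Q A = (\<integral>\<^sup>+\<omega>. ennreal (indicator (tail_pos t) \<omega>) * indicator A \<omega> \<partial>limit_measure)"
        using AP by (intro emeasure_density) auto
      also have "\<dots> = (\<integral>\<^sup>+\<omega>. indicator (A \<inter> tail_pos t) \<omega> \<partial>limit_measure)"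
        by (intro nn_integral_cong) (auto simp: indicator_def)
      finally show ?thesis using AP tp by (simp add: sets.Int)
    qed
    also have "\<dots> = ennreal (\<integral>\<omega>. indicator A \<omega> * max (M t \<omega>) 0 \<partial>P)"
      using t A by (rule emeasure_limit_measure_tail_pos)
    also have "\<dots> = (\<integral>\<^sup>+\<omega>. ennreal (indicator A \<omega> * max (M t \<omega>) 0) \<partial>P)"
      using t AP by (intro nn_integral_eq_integral[symmetric] integrable_bounded_mult[where C=1] integrable_max)
        (auto simp: integrable_M indicator_def)
    also have "\<dots> = emeasure ?R A"
      using AP by (subst emeasure_density) (auto intro!: nn_integral_cong simp: indicator_def)
    finally show "emeasure (restr_to_subalg ?Q (F t)) A = emeasure (restr_to_subalg ?R (F t)) A"
      by (simp only: emeasure_restr_to_subalg[OF subQ A] emeasure_restr_to_subalg[OF subR A])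
  qed (simp only: sets_restr_to_subalg[OF subQ] sets_restr_to_subalg[OF subR])
  note eq = this
  have "integrable P (\<lambda>\<omega>. f \<omega> * max (M t \<omega>) 0)"
    using t by (intro integrable_bounded_mult[OF fP bound] integrable_max) (auto simp: integrable_M)
  then have "integrable ?R f"
    by (subst integrable_real_density) (auto simp: mult.commute)
  then have "integrable ?Q f"
    using eq integrable_in_subalg[OF subR f] integrable_from_subalg[OF subQ] by simp
  then show "integrable limit_measure (\<lambda>\<omega>. indicator (tail_pos t) \<omega> * f \<omega>)"
    by (subst (asm) integrable_real_density) auto
  have "(\<integral>\<omega>. indicator (tail_pos t) \<omega> * f \<omega> \<partial>limit_measure) = integral\<^sup>L ?Q f"
    by (subst integral_real_density) auto
  also have "\<dots> = integral\<^sup>L ?R f"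
    using eq integral_subalgebra2[OF subQ f] integral_subalgebra2[OF subR f] by simp
  also have "\<dots> = (\<integral>\<omega>. f \<omega> * max (M t \<omega>) 0 \<partial>P)"
    by (subst integral_real_density) (auto simp: mult.commute)
  finally show "(\<integral>\<omega>. indicator (tail_pos t) \<omega> * f \<omega> \<partial>limit_measure) = (\<integral>\<omega>. f \<omega> * max (M t \<omega>) 0 \<partial>P)" .
qed

end

section \<open>The formula for the positive part at a stopping time\<close>

locale property_P_stopping_time = property_P_martingale P F M + bounded_stopping_time P F M T N
  for P :: "'a measure" and F M T N
begin

text \<open>The half-line is open at \<open>T\<close>, unlike in \<open>tail_pos\<close>, since a
  last zero at \<open>T\<close> itself is allowed.\<close>

definition last_before :: "'a set" where
  "last_before = {\<omega>\<in>space P. \<forall>u>T \<omega>. 0 < M u \<omega>}"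

lemma upper_grid_tail_pos_tendsto:
  assumes \<omega>: "\<omega> \<in> space P"
  shows "(\<lambda>k. indicator (tail_pos (upper_grid T k \<omega>)) \<omega> :: real) \<longlonglongrightarrow> indicator last_before \<omega>"
proof (cases "\<omega> \<in> last_before")
  case True
  then have "\<omega> \<in> tail_pos (upper_grid T k \<omega>)" for k
    using upper_grid_gt[of T \<omega> k, OF T_nonneg[OF \<omega>]] by (auto simp: last_before_def tail_pos_def)
  then show ?thesis using True by simp
next
  case False
  then obtain u where u: "T \<omega> < u" "M u \<omega> \<le> 0" using \<omega> by (auto simp: last_before_def not_less)
  have "\<forall>\<^sub>F k in sequentially. upper_grid T k \<omega> < u"
    using order_tendstoD(2)[OF upper_grid_tendsto[of T \<omega>, OF T_nonneg[OF \<omega>]] u(1)] .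
  then have "\<forall>\<^sub>F k in sequentially. indicator (tail_pos (upper_grid T k \<omega>)) \<omega> = (0::real)"
  proof eventually_elim
    case (elim k)
    then have "\<omega> \<notin> tail_pos (upper_grid T k \<omega>)" using u by (auto simp: tail_pos_def not_less intro: less_imp_le)
    then show ?case by simp
  qed
  then show ?thesis using False by (simp add: tendsto_eventually)
qed

text \<open>On the grid the identity is a finite sum of identities at fixed times. In the limit the
  side of \<open>P\<close> converges in L1, the side of \<open>limit_measure\<close> by dominated
  convergence.\<close>

lemma integral_limit_measure_last_before:
  assumes f: "f \<in> borel_measurable (pre_sigma T)" and bound: "\<And>\<omega>. \<omega> \<in> space P \<Longrightarrow> \<bar>f \<omega>\<bar> \<le> C"
  shows "integrable limit_measure (\<lambda>\<omega>. f \<omega> * indicator last_before \<omega>)"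
    and "(\<integral>\<omega>. f \<omega> * indicator last_before \<omega> \<partial>limit_measure) = (\<integral>\<omega>. f \<omega> * max (M (T \<omega>) \<omega>) 0 \<partial>P)"
proof -
  note fP[measurable] = pre_sigma_measurable_P[OF f]
  have fQ[measurable]: "f \<in> borel_measurable limit_measure"
    using fP measurable_cong_sets[OF sets_limit_measure refl] by blast
  have int_max: "integrable P (\<lambda>\<omega>. f \<omega> * max (M t \<omega>) 0)" if "0 \<le> t" for t
    using that by (intro integrable_bounded_mult[OF fP bound] integrable_max) (auto simp: integrable_M)
  have part_bound: "\<bar>indicator (grid_event k i) \<omega> * f \<omega>\<bar> \<le> \<bar>C\<bar>" if "\<omega> \<in> space P" for k i \<omega>
    using bound[OF that] by (auto simp: indicator_def)
  note part = integral_limit_measure_tail_pos[OF grid_time_nonneg measurable_grid_part[OF f] part_bound]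
  define h where "h k \<omega> = f \<omega> * indicator (tail_pos (upper_grid T k \<omega>)) \<omega>" for k \<omega>
  have h_eq: "h k \<omega> = (\<Sum>i\<le>grid_size k. indicator (tail_pos (grid_time k i)) \<omega> * (indicator (grid_event k i) \<omega> * f \<omega>))"
    if "\<omega> \<in> space limit_measure" for k \<omega>
    using sum_grid_event[of \<omega> k "\<lambda>i. indicator (tail_pos (grid_time k i)) \<omega> * f \<omega>"] that
    by (simp add: h_def upper_grid_def mult.commute mult.left_commute)
  have h_int: "integrable limit_measure (h k)" for k
    by (subst Bochner_Integration.integrable_cong[OF refl h_eq])
      (assumption | rule Bochner_Integration.integrable_sum part(1))+
  have "(\<integral>\<omega>. h k \<omega> \<partial>limit_measure) = (\<integral>\<omega>. f \<omega> * max (M (upper_grid T k \<omega>) \<omega>) 0 \<partial>P)" for k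
  proof -
    have "(\<integral>\<omega>. h k \<omega> \<partial>limit_measure) = (\<Sum>i\<le>grid_size k.
        \<integral>\<omega>. indicator (tail_pos (grid_time k i)) \<omega> * (indicator (grid_event k i) \<omega> * f \<omega>) \<partial>limit_measure)"
      by (subst Bochner_Integration.integral_cong[OF refl h_eq])
        (assumption | rule Bochner_Integration.integral_sum part(1))+
    also have "\<dots> = (\<Sum>i\<le>grid_size k. \<integral>\<omega>. indicator (grid_event k i) \<omega> * (f \<omega> * max (M (grid_time k i) \<omega>) 0) \<partial>P)"
      by (intro sum.cong refl) (simp add: part(2) mult.assoc)
    also have "\<dots> = (\<integral>\<omega>. f \<omega> * max (M (upper_grid T k \<omega>) \<omega>) 0 \<partial>P)"
      using integral_upper_grid(2)[OF fP, of "\<lambda>x. max x 0" k] int_max by simp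
    finally show ?thesis .
  qed
  moreover have "(\<lambda>k. \<integral>\<omega>. f \<omega> * max (M (upper_grid T k \<omega>) \<omega>) 0 \<partial>P) \<longlonglongrightarrow> (\<integral>\<omega>. f \<omega> * max (M (T \<omega>) \<omega>) 0 \<partial>P)"
  proof (rule tendsto_integral_mult_L1[OF _ _ _ fP bound])
    show 1: "integrable P (\<lambda>\<omega>. max (M (upper_grid T k \<omega>) \<omega>) 0)" for k
      by (intro integrable_max integrable_upper_grid) simp
    show 2: "integrable P (\<lambda>\<omega>. max (M (T \<omega>) \<omega>) 0)"
      by (intro integrable_max integrable_stopped) simp
    show "(\<lambda>k. \<integral>\<omega>. \<bar>max (M (upper_grid T k \<omega>) \<omega>) 0 - max (M (T \<omega>) \<omega>) 0\<bar> \<partial>P) \<longlonglongrightarrow> 0"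
    \<comment> \<open>Taking positive parts is 1-Lipschitz, so L1 convergence is inherited.\<close>
    proof (rule Lim_null_comparison[OF always_eventually upper_grid_L1], rule allI)
      fix k
      have "(\<integral>\<omega>. \<bar>max (M (upper_grid T k \<omega>) \<omega>) 0 - max (M (T \<omega>) \<omega>) 0\<bar> \<partial>P) \<le>
          (\<integral>\<omega>. \<bar>M (upper_grid T k \<omega>) \<omega> - M (T \<omega>) \<omega>\<bar> \<partial>P)"
        by (intro integral_mono integrable_abs Bochner_Integration.integrable_diff 1 2 integrable_upper_grid integrable_stopped) auto
      then show "norm (\<integral>\<omega>. \<bar>max (M (upper_grid T k \<omega>) \<omega>) 0 - max (M (T \<omega>) \<omega>) 0\<bar> \<partial>P) \<le>
          (\<integral>\<omega>. \<bar>M (upper_grid T k \<omega>) \<omega> - M (T \<omega>) \<omega>\<bar> \<partial>P)" by simp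
    qed
  qed
  ultimately have lim_P: "(\<lambda>k. \<integral>\<omega>. h k \<omega> \<partial>limit_measure) \<longlonglongrightarrow> (\<integral>\<omega>. f \<omega> * max (M (T \<omega>) \<omega>) 0 \<partial>P)"
    by simp
  have h_lim: "(\<lambda>k. h k \<omega>) \<longlonglongrightarrow> f \<omega> * indicator last_before \<omega>" if "\<omega> \<in> space P" for \<omega>
    unfolding h_def by (intro tendsto_mult tendsto_const upper_grid_tail_pos_tendsto that)
  \<comment> \<open>The measure may be infinite, so a constant cannot dominate. The tail event at
    time N + 1 has finite measure and contains all tail events at the grid times.\<close>
  let ?w = "\<lambda>\<omega>. indicator (tail_pos (real (Suc N))) \<omega> * \<bar>C\<bar>"
  have w: "integrable limit_measure ?w"
    by (rule integral_limit_measure_tail_pos(1)[where C="\<bar>C\<bar>"]) auto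
  have h_meas: "h k \<in> borel_measurable limit_measure" for k using h_int by auto
  have last_meas: "(\<lambda>\<omega>. f \<omega> * indicator last_before \<omega>) \<in> borel_measurable limit_measure"
  proof (rule borel_measurable_LIMSEQ_real)
    show "(\<lambda>k. h k \<omega>) \<longlonglongrightarrow> f \<omega> * indicator last_before \<omega>" if "\<omega> \<in> space limit_measure" for \<omega>
      using that by (intro h_lim) simp
  qed (rule h_meas)
  have h_le: "norm (h k \<omega>) \<le> ?w \<omega>" if "\<omega> \<in> space P" for k \<omega>
  proof -
    have "upper_grid T k \<omega> \<le> real (Suc N)"
      unfolding upper_grid_def by (intro grid_time_le grid_index_le that)
    then have "tail_pos (upper_grid T k \<omega>) \<subseteq> tail_pos (real (Suc N))" by (rule tail_pos_mono)
    then show ?thesis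
      using bound[OF that] by (auto simp: h_def indicator_def)
  qed
  have dom: "AE \<omega> in limit_measure. (\<lambda>k. h k \<omega>) \<longlonglongrightarrow> f \<omega> * indicator last_before \<omega>"
    "\<And>k. AE \<omega> in limit_measure. norm (h k \<omega>) \<le> ?w \<omega>"
    using h_lim h_le by (auto intro!: AE_I2)
  show "integrable limit_measure (\<lambda>\<omega>. f \<omega> * indicator last_before \<omega>)"
    by (rule integrable_dominated_convergence[OF last_meas h_meas w dom])
  have "(\<lambda>k. \<integral>\<omega>. h k \<omega> \<partial>limit_measure) \<longlonglongrightarrow> (\<integral>\<omega>. f \<omega> * indicator last_before \<omega> \<partial>limit_measure)"
    by (rule integral_dominated_convergence[OF last_meas h_meas w dom])
  then show "(\<integral>\<omega>. f \<omega> * indicator last_before \<omega> \<partial>limit_measure) = (\<integral>\<omega>. f \<omega> * max (M (T \<omega>) \<omega>) 0 \<partial>P)"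
    using lim_P LIMSEQ_unique by blast
qed

end

section \<open>Last zeros and uniqueness\<close>

text \<open>Transfers integrals to functions of the last zero, for which measurability is available
  only with respect to the completion.\<close>

lemma completion_cong_AE:
  fixes g h :: "'a \<Rightarrow> real"
  assumes g: "integrable Q g" and eq: "AE x in Q. g x = h x"
  shows "integrable (completion Q) h" "(\<integral>x. h x \<partial>completion Q) = (\<integral>x. g x \<partial>Q)"
proof -
  have gm: "g \<in> borel_measurable Q" using g by auto
  then have gc: "g \<in> borel_measurable (completion Q)" by (rule measurable_completion)
  have eqc: "AE x in completion Q. g x = h x" using eq by (rule AE_completion)
  have hm: "h \<in> borel_measurable (completion Q)"
  proof (rule measurableI)
    fix B :: "real set" assume B: "B \<in> sets borel"
    show "h -` B \<inter> space (completion Q) \<in> sets (completion Q)"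
    proof (rule completion.in_sets_AE)
      show "g -` B \<inter> space (completion Q) \<in> sets (completion Q)"
        using gc B by (rule measurable_sets)
      show "AE x in completion Q. x \<in> g -` B \<inter> space (completion Q) \<longleftrightarrow> x \<in> h -` B \<inter> space (completion Q)"
        using eqc by eventually_elim auto
    qed auto
  qed simp
  have "integrable (completion Q) g" using g gm by (simp add: integrable_completion)
  then show "integrable (completion Q) h"
    using integrable_cong_AE_imp[OF _ hm] eqc by (auto simp: eq_commute)
  have "(\<integral>x. h x \<partial>completion Q) = (\<integral>x. g x \<partial>completion Q)"
    using eqc by (intro integral_cong_AE hm gc) (auto simp: eq_commute)
  then show "(\<integral>x. h x \<partial>completion Q) = (\<integral>x. g x \<partial>Q)"
    using gm by (simp add: integral_completion)
qed

lemma last_zero_le_iff: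
  assumes "0 \<le> t"
  shows "last_zero X \<omega> \<le> ennreal t \<longleftrightarrow> (\<forall>u>t. X u \<omega> \<noteq> 0)"
proof
  assume le: "last_zero X \<omega> \<le> ennreal t"
  show "\<forall>u>t. X u \<omega> \<noteq> 0"
  proof (intro allI impI notI)
    fix u assume u: "t < u" "X u \<omega> = 0"
    then have "ennreal u \<le> last_zero X \<omega>"
      using assms unfolding last_zero_def by (intro Sup_upper) auto
    then have "ennreal u \<le> ennreal t" using le by (rule order_trans)
    then show False using u assms by (simp add: ennreal_le_iff)
  qed
next
  assume "\<forall>u>t. X u \<omega> \<noteq> 0"
  then show "last_zero X \<omega> \<le> ennreal t"
    unfolding last_zero_def by (intro Sup_least) (auto intro!: ennreal_leI intro: leI)
qed

lemma last_zero_uminus: "last_zero (\<lambda>t \<omega>. - X t \<omega> :: real) = last_zero X"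
  by (simp add: last_zero_def fun_eq_iff)

lemma ennreal_le_last_zero: "0 \<le> t \<Longrightarrow> X t \<omega> = 0 \<Longrightarrow> ennreal t \<le> last_zero X \<omega>"
  unfolding last_zero_def by (intro Sup_upper) auto

text \<open>If the last zero of the positive part is finite, the path is eventually positive, so
  every time with \<open>M \<le> 0\<close> is followed by a zero of \<open>M\<close>. Finiteness
  matters: on an always negative path the two values are 0 and infinity.\<close>

lemma last_zero_positive_part:
  assumes cont: "continuous_on {0..} (\<lambda>t. M t \<omega> :: real)"
    and fin: "last_zero (\<lambda>t \<omega>. max (M t \<omega>) 0) \<omega> \<noteq> \<infinity>"
  shows "last_zero M \<omega> = last_zero (\<lambda>t \<omega>. max (M t \<omega>) 0) \<omega>"
proof (rule antisym)
  let ?X = "\<lambda>t \<omega>. max (M t \<omega>) 0"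
  show "last_zero M \<omega> \<le> last_zero ?X \<omega>"
    unfolding last_zero_def by (intro Sup_subset_mono) auto
  obtain r where r: "0 \<le> r" "last_zero ?X \<omega> = ennreal r"
    using fin by (cases "last_zero ?X \<omega>") auto
  show "last_zero ?X \<omega> \<le> last_zero M \<omega>"
    unfolding last_zero_def[of ?X]
  proof (intro Sup_least, clarify)
    fix u assume u: "0 \<le> u" "max (M u \<omega>) 0 = 0"
    \<comment> \<open>A time beyond u at which the path is certainly positive, being strictly beyond
      r.\<close>
    define w where "w = max r u + 1"
    have "\<forall>v>r. ?X v \<omega> \<noteq> 0" using last_zero_le_iff[OF r(1), of ?X \<omega>] r(2) by simp
    then have "max (M w \<omega>) 0 \<noteq> 0" by (simp add: w_def)
    then have "0 < M w \<omega>" by linarith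
    moreover have "M u \<omega> \<le> 0" using u(2) by linarith
    moreover have "u \<le> w" by (simp add: w_def)
    moreover have "continuous_on {u..w} (\<lambda>t. M t \<omega>)"
      using u by (intro continuous_on_subset[OF cont]) auto
    ultimately obtain v where v: "u \<le> v" "M v \<omega> = 0"
      using IVT'[of "\<lambda>t. M t \<omega>" u 0 w] by auto
    then have "ennreal u \<le> ennreal v" by (intro ennreal_leI)
    also have "\<dots> \<le> last_zero M \<omega>" using v u by (intro ennreal_le_last_zero) auto
    finally show "ennreal u \<le> last_zero M \<omega>" .
  qed
qed

section \<open>Identification and uniqueness of the associated measure\<close>

context property_P_martingale
begin

abbreviation pos_part :: "real \<Rightarrow> 'a \<Rightarrow> real" where
  "pos_part t \<omega> \<equiv> max (M t \<omega>) 0"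

lemma pos_part_zero_iff: "pos_part t \<omega> \<noteq> 0 \<longleftrightarrow> 0 < M t \<omega>"
  by (auto simp: max_def)

lemma last_zero_pos_part_le_iff:
  "0 \<le> t \<Longrightarrow> last_zero pos_part \<omega> \<le> ennreal t \<longleftrightarrow> (\<forall>u>t. 0 < M u \<omega>)"
  using last_zero_le_iff[of t pos_part \<omega>] by (simp only: pos_part_zero_iff)

lemma tail_pos_imp_last_zero_le: "0 \<le> t \<Longrightarrow> \<omega> \<in> tail_pos t \<Longrightarrow> last_zero pos_part \<omega> \<le> ennreal t"
  by (simp add: last_zero_pos_part_le_iff tail_pos_def)

lemma AE_last_zero_finite: "AE \<omega> in limit_measure. last_zero pos_part \<omega> \<noteq> \<infinity>"
  using AE_limit_measure
proof eventually_elim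
  case (elim \<omega>)
  then obtain n :: nat where "last_zero pos_part \<omega> \<le> ennreal (real n)"
    using tail_pos_imp_last_zero_le[of "real n" \<omega> for n] by auto
  then show ?case by (auto simp: top_unique)
qed

lemma AE_last_zero_eq: "AE \<omega> in limit_measure. last_zero M \<omega> = last_zero pos_part \<omega>"
  using AE_last_zero_finite AE_space
  by eventually_elim (intro last_zero_positive_part path, auto)

text \<open>Both last zeros are covered: \<open>associated_measure\<close> speaks of that of the
  positive part, while that of \<open>M\<close> is common to both signs and enters the final
  formula.\<close>

lemma stopped_formula:
  assumes T: "stopping_time F T" "\<forall>\<omega>\<in>space P. 0 \<le> T \<omega>" "bounded (T ` space P)"
    and f: "f \<in> borel_measurable (pre_sigma T)" "bounded (f ` space P)"
  shows "integrable (completion limit_measure) (\<lambda>\<omega>. f \<omega> * indicator {\<omega>. last_zero pos_part \<omega> \<le> ennreal (T \<omega>)} \<omega>)"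
    and "integrable (completion limit_measure) (\<lambda>\<omega>. f \<omega> * indicator {\<omega>. last_zero M \<omega> \<le> ennreal (T \<omega>)} \<omega>)"
    and "(\<integral>\<omega>. f \<omega> * indicator {\<omega>. last_zero pos_part \<omega> \<le> ennreal (T \<omega>)} \<omega> \<partial>completion limit_measure) =
      (\<integral>\<omega>. f \<omega> * pos_part (T \<omega>) \<omega> \<partial>P)"
    and "(\<integral>\<omega>. f \<omega> * indicator {\<omega>. last_zero M \<omega> \<le> ennreal (T \<omega>)} \<omega> \<partial>completion limit_measure) =
      (\<integral>\<omega>. f \<omega> * pos_part (T \<omega>) \<omega> \<partial>P)"
    and "integrable P (\<lambda>\<omega>. f \<omega> * M (T \<omega>) \<omega>)"
    and "integrable P (\<lambda>\<omega>. f \<omega> * pos_part (T \<omega>) \<omega>)"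
proof -
  obtain b where b: "\<And>\<omega>. \<omega> \<in> space P \<Longrightarrow> \<bar>T \<omega>\<bar> \<le> b"
    using T(3) by (auto simp: bounded_iff)
  obtain N :: nat where N: "b \<le> real N" using real_arch_simple by blast
  obtain C where C: "\<And>\<omega>. \<omega> \<in> space P \<Longrightarrow> \<bar>f \<omega>\<bar> \<le> C"
    using f(2) by (auto simp: bounded_iff)
  interpret S: property_P_stopping_time P F M T N
  proof unfold_locales
    show "T \<omega> \<le> real N" if "\<omega> \<in> space P" for \<omega> using b[OF that] N by linarith
  qed (use T in auto)
  have eq: "\<omega> \<in> S.last_before \<longleftrightarrow> last_zero pos_part \<omega> \<le> ennreal (T \<omega>)" if "\<omega> \<in> space P" for \<omega>
    using that T(2) by (simp add: S.last_before_def last_zero_pos_part_le_iff)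
  have 1: "AE \<omega> in limit_measure. f \<omega> * indicator S.last_before \<omega> =
      f \<omega> * indicator {\<omega>. last_zero pos_part \<omega> \<le> ennreal (T \<omega>)} \<omega>"
    using eq by (intro AE_I2) (simp add: indicator_def)
  have 2: "AE \<omega> in limit_measure. f \<omega> * indicator S.last_before \<omega> =
      f \<omega> * indicator {\<omega>. last_zero M \<omega> \<le> ennreal (T \<omega>)} \<omega>"
    using 1 AE_last_zero_eq by eventually_elim (simp add: indicator_def)
  note int = S.integral_limit_measure_last_before[OF f(1) C]
  show "integrable (completion limit_measure) (\<lambda>\<omega>. f \<omega> * indicator {\<omega>. last_zero pos_part \<omega> \<le> ennreal (T \<omega>)} \<omega>)"
    "integrable (completion limit_measure) (\<lambda>\<omega>. f \<omega> * indicator {\<omega>. last_zero M \<omega> \<le> ennreal (T \<omega>)} \<omega>)"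
    "(\<integral>\<omega>. f \<omega> * indicator {\<omega>. last_zero pos_part \<omega> \<le> ennreal (T \<omega>)} \<omega> \<partial>completion limit_measure) =
      (\<integral>\<omega>. f \<omega> * pos_part (T \<omega>) \<omega> \<partial>P)"
    "(\<integral>\<omega>. f \<omega> * indicator {\<omega>. last_zero M \<omega> \<le> ennreal (T \<omega>)} \<omega> \<partial>completion limit_measure) =
      (\<integral>\<omega>. f \<omega> * pos_part (T \<omega>) \<omega> \<partial>P)"
    using completion_cong_AE[OF int(1) 1] completion_cong_AE[OF int(1) 2] int(2) by simp_all
  show "integrable P (\<lambda>\<omega>. f \<omega> * M (T \<omega>) \<omega>)"
    by (rule integrable_bounded_mult[OF S.pre_sigma_measurable_P[OF f(1)] C S.integrable_stopped])
  show "integrable P (\<lambda>\<omega>. f \<omega> * pos_part (T \<omega>) \<omega>)"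
    by (rule integrable_bounded_mult[OF S.pre_sigma_measurable_P[OF f(1)] C])
      (auto intro: integrable_max S.integrable_stopped)
qed

text \<open>A deterministic time is a stopping time whose \<sigma>-algebra contains
  \<open>F t\<close>.\<close>

lemma associated_limit_measure: "associated_measure P F pos_part limit_measure"
  unfolding associated_measure_def
proof (intro conjI allI impI ballI)
  fix t :: real and f :: "'a \<Rightarrow> real" assume t: "0 \<le> t" and f: "f \<in> borel_measurable (F t)" "bounded (f ` space P)"
  have "sets (F t) \<subseteq> sets (pre_sigma (\<lambda>_. t))"
  proof
    fix A assume A: "A \<in> sets (F t)"
    show "A \<in> sets (pre_sigma (\<lambda>_. t))"
    proof (rule sets_pre_sigmaI[OF stopping_time_const])
      show "{\<omega>\<in>A. t \<le> u} \<in> sets (F u)" for u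
        using A sets_F_mono[of t u] by (cases "t \<le> u") auto
    qed
  qed
  then have f': "f \<in> borel_measurable (pre_sigma (\<lambda>_. t))"
    using f(1) by (auto simp: measurable_def space_F space_pre_sigma)
  note S = stopped_formula[OF stopping_time_const[of F t] _ _ f' f(2)]
  show "integrable (completion limit_measure) (\<lambda>\<omega>. f \<omega> * indicator {\<omega>. last_zero pos_part \<omega> \<le> ennreal t} \<omega>)"
    "(\<integral>\<omega>. f \<omega> * indicator {\<omega>. last_zero pos_part \<omega> \<le> ennreal t} \<omega> \<partial>completion limit_measure) =
      (\<integral>\<omega>. f \<omega> * pos_part t \<omega> \<partial>P)"
    using S(1,3) t by (auto simp: bounded_iff)
qed (auto simp: sigma_finite_limit_measure AE_last_zero_finite[simplified])

text \<open>Among the paths with last zero at most t, those in \<open>tail_pos n\<close> are singled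
  out by \<open>pos n t\<close>, an event of \<open>F t\<close>. Testing the defining identity with
  its indicator, cut down to \<open>A\<close>, forces the value.\<close>

lemma associated_measure_tail_pos:
  assumes Q: "associated_measure P F pos_part Q" and n: "real n \<le> t" and A: "A \<in> sets (F t)"
  shows "emeasure Q (A \<inter> tail_pos n) = ennreal (mass n t A)"
proof -
  have sQ[simp]: "sets Q = sets P" using Q by (simp add: associated_measure_def)
  have spQ: "space Q = space P" using sets_eq_imp_space_eq[OF sQ] .
  have AP: "A \<in> sets P" using A sets_F_le by blast
  define f where "f = (indicator (A \<inter> pos n t) :: 'a \<Rightarrow> real)"
  have p: "pos n t \<in> sets (F t)" using n by (intro pos_sets) auto
  have f: "f \<in> borel_measurable (F t)" unfolding f_def using A p by simp
  have "bounded (f ` space P)" unfolding f_def bounded_iff by (intro exI[of _ 1]) (auto simp: indicator_def)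
  then have int: "integrable (completion Q) (\<lambda>\<omega>. f \<omega> * indicator {\<omega>. last_zero pos_part \<omega> \<le> ennreal t} \<omega>)"
    and eq: "(\<integral>\<omega>. f \<omega> * indicator {\<omega>. last_zero pos_part \<omega> \<le> ennreal t} \<omega> \<partial>completion Q) =
      (\<integral>\<omega>. f \<omega> * pos_part t \<omega> \<partial>P)"
    using Q f n unfolding associated_measure_def by auto
  let ?S = "A \<inter> tail_pos (real n)"
  have S: "?S \<in> sets Q" using AP by simp
  have fS: "f \<omega> * indicator {\<omega>. last_zero pos_part \<omega> \<le> ennreal t} \<omega> = indicator ?S \<omega>"
    if "\<omega> \<in> space (completion Q)" for \<omega>
  proof -
    have "\<omega> \<in> tail_pos (real n) \<longleftrightarrow> \<omega> \<in> pos n t \<and> last_zero pos_part \<omega> \<le> ennreal t"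
      using n that by (auto simp: tail_pos_def pos_def last_zero_pos_part_le_iff spQ)
    then show ?thesis by (auto simp: f_def indicator_def)
  qed
  have intS: "integrable Q (indicator ?S :: 'a \<Rightarrow> real)"
  proof -
    have "integrable (completion Q) (indicator ?S :: 'a \<Rightarrow> real)"
      by (rule iffD1[OF Bochner_Integration.integrable_cong[OF refl fS] int])
    then show ?thesis by (simp only: integrable_completion[OF borel_measurable_indicator[OF S]])
  qed
  have "emeasure Q ?S = (\<integral>\<^sup>+\<omega>. ennreal (indicator ?S \<omega>) \<partial>Q)"
    using S by (simp add: ennreal_indicator)
  also have "\<dots> = ennreal (\<integral>\<omega>. indicator ?S \<omega> \<partial>Q)"
    by (rule nn_integral_eq_integral[OF intS]) simp
  also have "(\<integral>\<omega>. indicator ?S \<omega> \<partial>Q) = (\<integral>\<omega>. indicator ?S \<omega> \<partial>completion Q :: real)"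
    by (simp only: integral_completion[OF borel_measurable_indicator[OF S]])
  also have "\<dots> = (\<integral>\<omega>. f \<omega> * pos_part t \<omega> \<partial>P)"
    unfolding eq[symmetric] by (rule Bochner_Integration.integral_cong[OF refl fS, symmetric])
  also have "\<dots> = mass n t A"
    unfolding mass_def
  proof (rule Bochner_Integration.integral_cong[OF refl])
    fix \<omega>
    have "0 < M t \<omega>" if "\<omega> \<in> pos n t" using that n by (auto simp: pos_def)
    then show "f \<omega> * pos_part t \<omega> = indicator (A \<inter> pos n t) \<omega> * M t \<omega>"
      by (auto simp: f_def indicator_def)
  qed
  finally show ?thesis .
qed

text \<open>The restrictions to the tail events are finite measures with prescribed values on a
  generating family. Finiteness of the last zero almost everywhere makes these events exhaust
  \<open>Q\<close>.\<close>

lemma associated_measure_unique: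
  assumes Q: "associated_measure P F pos_part Q"
  shows "Q = limit_measure"
proof (rule measure_eqI)
  have sQ[simp]: "sets Q = sets P" using Q by (simp add: associated_measure_def)
  have spQ: "space Q = space P" using sets_eq_imp_space_eq[OF sQ] .
  show "sets Q = sets limit_measure" by simp
  fix A assume "A \<in> sets Q"
  then have A: "A \<in> sets P" by simp
  have d: "emeasure (density Q (indicator (tail_pos (real n)))) B = emeasure Q (B \<inter> tail_pos (real n))"
    if "B \<in> sets P" for B and n :: nat
    using that by (subst emeasure_restricted) (auto simp: Int_commute)
  have "mass_measure n = density Q (indicator (tail_pos (real n)))" for n
  proof (rule eq_measure_if_eq_on_F[where n=n])
    show "emeasure (mass_measure n) (space P) \<noteq> \<infinity>"
      using finite_measure.emeasure_finite[OF finite_mass_measure] by simp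
    fix k B assume k: "n \<le> k" and B: "B \<in> sets (F (real k))"
    have BP: "B \<in> sets P" using B sets_F_le by blast
    show "emeasure (mass_measure n) B = emeasure (density Q (indicator (tail_pos (real n)))) B"
      using k B BP d associated_measure_tail_pos[OF Q, of n "real k" B]
        emeasure_mass_measure[of n "real k" B] by simp
  qed auto
  then have part: "emeasure (mass_measure n) A = emeasure Q (A \<inter> tail_pos (real n))" for n
    using d[OF A] by simp
  have "AE \<omega> in Q. last_zero pos_part \<omega> \<noteq> \<infinity>" using Q by (simp add: associated_measure_def)
  then have AE: "AE \<omega> in Q. \<omega> \<in> A \<longleftrightarrow> \<omega> \<in> (\<Union>n::nat. A \<inter> tail_pos (real n))"
    using AE_space
  proof eventually_elim
    case (elim \<omega>)
    then obtain r where r: "0 \<le> r" "last_zero pos_part \<omega> = ennreal r"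
      by (cases "last_zero pos_part \<omega>") auto
    \<comment> \<open>Strict inequality, because the path is positive only after r while
      \<open>tail_pos\<close> includes its starting time.\<close>
    obtain n :: nat where n: "r < real n" using reals_Archimedean2 by blast
    have "\<forall>u>r. 0 < M u \<omega>" using last_zero_pos_part_le_iff[OF r(1), of \<omega>] r(2) by simp
    then have "\<omega> \<in> tail_pos (real n)" using n elim by (auto simp: tail_pos_def spQ)
    then show ?case by auto
  qed
  have "emeasure Q A = emeasure Q (\<Union>n::nat. A \<inter> tail_pos (real n))"
    using AE A by (intro emeasure_eq_AE) auto
  also have "\<dots> = (SUP n::nat. emeasure Q (A \<inter> tail_pos (real n)))"
    using A tail_pos_mono by (intro SUP_emeasure_incseq[symmetric] incseq_SucI Int_mono) auto
  also have "\<dots> = emeasure limit_measure A"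
    using part by (simp add: emeasure_limit_measure[OF A])
  finally show "emeasure Q A = emeasure limit_measure A" .
qed

end

section \<open>Passage to both signs\<close>

lemma property_P_martingaleI:
  assumes "prob_space P" "property_P P F" "continuous_martingale P F M"
  shows "property_P_martingale P F M"
proof -
  interpret prob_space P by fact
  interpret filtration "space P" F
    using assms(2) by (simp add: property_P_def)
  have sets_P: "sets P = sigma_sets (space P) (\<Union>t\<in>{0..}. sets (F t))"
    using assms(2) by (simp add: property_P_def)
  have "sets (F t) \<subseteq> sets P" for t
  proof -
    \<comment> \<open>The generators of \<open>P\<close> involve nonnegative times only; a negative
      time is compared with time 0.\<close>
    have "sets (F t) \<subseteq> sets (F (max t 0))" by (intro sets_F_mono) simp
    also have "\<dots> \<subseteq> sets P" unfolding sets_P by (auto intro!: sigma_sets.Basic bexI[of _ "max t 0"])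
    finally show ?thesis .
  qed
  then show ?thesis
    using assms by unfold_locales auto
qed

lemma continuous_martingale_uminus:
  assumes "prob_space P" "property_P P F" "continuous_martingale P F M"
  shows "continuous_martingale P F (\<lambda>t \<omega>. - M t \<omega>)"
proof -
  interpret property_P_martingale P F M by (rule property_P_martingaleI) fact+
  have "AE \<omega> in P. real_cond_exp P (F s) (\<lambda>\<omega>. - M t \<omega>) \<omega> = - M s \<omega>" if st: "0 \<le> s" "s \<le> t" for s t
  proof -
    interpret sigma_finite_subalgebra P "F s"
      by (rule sigma_finite_subalgebra_F)
    have "AE \<omega> in P. real_cond_exp P (F s) (\<lambda>\<omega>. - 1 * M t \<omega>) \<omega> = - 1 * real_cond_exp P (F s) (M t) \<omega>"
      using st by (intro real_cond_exp_cmult integrable_M) simp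
    moreover have "AE \<omega> in P. real_cond_exp P (F s) (M t) \<omega> = M s \<omega>"
      using martingale st by (simp add: continuous_martingale_def)
    ultimately show ?thesis by eventually_elim simp
  qed
  then show ?thesis
    using martingale by (auto simp: continuous_martingale_def intro: continuous_on_minus)
qed

theorem proposition2p11:
  fixes P :: "'a measure"
    and F :: "real \<Rightarrow> 'a measure"
    and M :: "real \<Rightarrow> 'a \<Rightarrow> real"
  assumes "prob_space P"
    and "property_P P F"
    and "continuous_martingale P F M"
  shows "\<exists>Qp Qm.
    associated_measure P F (\<lambda>t \<omega>. max (M t \<omega>) 0) Qp \<and>
    (\<forall>Q. associated_measure P F (\<lambda>t \<omega>. max (M t \<omega>) 0) Q \<longrightarrow> Q = Qp) \<and>
    associated_measure P F (\<lambda>t \<omega>. max (- M t \<omega>) 0) Qm \<and>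
    (\<forall>Q. associated_measure P F (\<lambda>t \<omega>. max (- M t \<omega>) 0) Q \<longrightarrow> Q = Qm) \<and>
    (\<forall>T f. stopping_time F T \<and> (\<forall>\<omega>\<in>space P. 0 \<le> T \<omega>) \<and> bounded (T ` space P) \<and>
        f \<in> borel_measurable (filtration.pre_sigma (space P) F T) \<and> bounded (f ` space P) \<longrightarrow>
      integrable (completion Qp) (\<lambda>\<omega>. f \<omega> * indicator {\<omega>. last_zero M \<omega> \<le> ennreal (T \<omega>)} \<omega>) \<and>
      integrable (completion Qm) (\<lambda>\<omega>. f \<omega> * indicator {\<omega>. last_zero M \<omega> \<le> ennreal (T \<omega>)} \<omega>) \<and>
      integrable P (\<lambda>\<omega>. f \<omega> * M (T \<omega>) \<omega>) \<and>
      (\<integral>\<omega>. f \<omega> * indicator {\<omega>. last_zero M \<omega> \<le> ennreal (T \<omega>)} \<omega> \<partial>completion Qp)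
        - (\<integral>\<omega>. f \<omega> * indicator {\<omega>. last_zero M \<omega> \<le> ennreal (T \<omega>)} \<omega> \<partial>completion Qm)
        = (\<integral>\<omega>. f \<omega> * M (T \<omega>) \<omega> \<partial>P))"
proof -
  interpret plus: property_P_martingale P F M
    by (rule property_P_martingaleI) fact+
  interpret minus: property_P_martingale P F "\<lambda>t \<omega>. - M t \<omega>"
    by (rule property_P_martingaleI continuous_martingale_uminus | fact)+
  show ?thesis
  proof (intro exI conjI allI impI)
    show "associated_measure P F (\<lambda>t \<omega>. max (M t \<omega>) 0) plus.limit_measure"
      by (rule plus.associated_limit_measure)
    show "associated_measure P F (\<lambda>t \<omega>. max (- M t \<omega>) 0) minus.limit_measure"
      by (rule minus.associated_limit_measure)
    show "Q = plus.limit_measure" if "associated_measure P F (\<lambda>t \<omega>. max (M t \<omega>) 0) Q" for Q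
      using that by (rule plus.associated_measure_unique)
    show "Q = minus.limit_measure" if "associated_measure P F (\<lambda>t \<omega>. max (- M t \<omega>) 0) Q" for Q
      using that by (rule minus.associated_measure_unique)
    fix T :: "'a \<Rightarrow> real" and f :: "'a \<Rightarrow> real"
    assume "stopping_time F T \<and> (\<forall>\<omega>\<in>space P. 0 \<le> T \<omega>) \<and> bounded (T ` space P) \<and>
        f \<in> borel_measurable (plus.pre_sigma T) \<and> bounded (f ` space P)"
    then have Tf: "stopping_time F T" "\<forall>\<omega>\<in>space P. 0 \<le> T \<omega>" "bounded (T ` space P)"
      "f \<in> borel_measurable (plus.pre_sigma T)" "bounded (f ` space P)" by auto
    \<comment> \<open>Changing the sign leaves the zeros in place, so both formulas concern the same
      event, and their difference is governed by x = max x 0 - max (-x) 0.\<close>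
    note p = plus.stopped_formula[OF Tf] and m = minus.stopped_formula[OF Tf, unfolded last_zero_uminus]
    show "integrable (completion plus.limit_measure) (\<lambda>\<omega>. f \<omega> * indicator {\<omega>. last_zero M \<omega> \<le> ennreal (T \<omega>)} \<omega>)"
      by (rule p(2))
    show "integrable (completion minus.limit_measure) (\<lambda>\<omega>. f \<omega> * indicator {\<omega>. last_zero M \<omega> \<le> ennreal (T \<omega>)} \<omega>)"
      by (rule m(2))
    show "integrable P (\<lambda>\<omega>. f \<omega> * M (T \<omega>) \<omega>)"
      by (rule p(5))
    have "(\<integral>\<omega>. f \<omega> * max (M (T \<omega>) \<omega>) 0 \<partial>P) - (\<integral>\<omega>. f \<omega> * max (- M (T \<omega>) \<omega>) 0 \<partial>P) =
        (\<integral>\<omega>. f \<omega> * max (M (T \<omega>) \<omega>) 0 - f \<omega> * max (- M (T \<omega>) \<omega>) 0 \<partial>P)"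
      using p(6) m(6) by (rule Bochner_Integration.integral_diff[symmetric])
    also have "\<dots> = (\<integral>\<omega>. f \<omega> * M (T \<omega>) \<omega> \<partial>P)"
      by (intro Bochner_Integration.integral_cong) (auto simp: max_def)
    finally show "(\<integral>\<omega>. f \<omega> * indicator {\<omega>. last_zero M \<omega> \<le> ennreal (T \<omega>)} \<omega> \<partial>completion plus.limit_measure)
        - (\<integral>\<omega>. f \<omega> * indicator {\<omega>. last_zero M \<omega> \<le> ennreal (T \<omega>)} \<omega> \<partial>completion minus.limit_measure)
        = (\<integral>\<omega>. f \<omega> * M (T \<omega>) \<omega> \<partial>P)"
      using p(4) m(4) by simp
  qed
qed

end
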